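(* Let $d\ge 1$ and let $\lambda_1,\dots,\lambda_m$ be linear forms on $\mathbb{R}^d$. Let $\mathbf{1}\in\mathbb{R}^d$ be the vector all of whose coordinates equal $1$, and suppose $\lambda_i(\mathbf{1})=0$ for all $i=1,\dots,m$. Set $$C=\{x\in\mathbb{R}^d_+:\ \lambda_i(x)\ge 0,\ i=1,\dots,m\},\qquad D=\{x\in\mathbb{R}^d_+:\ \lambda_i(x)>0,\ i=1,\dots,m\},$$ and define the semiopen polytope $\mathcal{P}=\{x\in D:\ \sum_{i=1}^d x_i=1\}$, with closure $\overline{\mathcal{P}}$. If $\dim\mathcal{P}=d-1$, then: (1) $J=I-\mathbf{1}$, where $J$ is the set of lattice points (points of $\mathbb{Z}^d$) in $D$ and $I$ is the set of lattice points in the interior of $C$; (2) $E_{\mathcal{P}}(t)=(-1)^d\,t^{-d}\,E_{\overline{\mathcal{P}}}(t^{-1})$ as rational functions; (3) if $$E_{\overline{\mathcal{P}}}(t)=\frac{h_0+h_1t+\dots+h_st^s}{(1-t^{g_1})\cdots(1-t^{g_d})}$$ with integers $h_i$ and positive integers $g_i$, then the Ehrhart series of $\mathcal{P}$ is $$E_{\mathcal{P}}(t)=\frac{h_st^w+h_{s-1}t^{w+1}+\dots+h_0t^{w+s}}{(1-t^{g_1})\cdots(1-t^{g_d})},\qquad w=\sum_{i=1}^d g_i-d-s.$$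
   Context: $\mathbb{R}^d_+$ denotes the nonnegative orthant $\{x\in\mathbb{R}^d: x_i\ge 0 \text{ for all } i\}$. For a (possibly semiopen) polytope $\mathcal{Q}\subset\{x:\sum_i x_i=1\}$, its Ehrhart function is $E(\mathcal{Q},k)=\#(k\mathcal{Q}\cap\mathbb{Z}^d)$, i.e. the number of lattice points of the cone over $\mathcal{Q}$ with coordinate sum (total degree) $k$, and its Ehrhart series is the generating function $E_{\mathcal{Q}}(t)=\sum_{k\ge 0}E(\mathcal{Q},k)t^k$; thus $E_{\mathcal{P}}(t)=\sum_{x\in D\cap\mathbb{Z}^d}t^{\sum_i x_i}$ and $E_{\overline{\mathcal{P}}}(t)=\sum_{x\in C\cap\mathbb{Z}^d}t^{\sum_i x_i}$. These power series are expansions of rational functions, and identities are understood as identities of rational functions.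
   Formalization: Parts (2) and (3) are proved when each linear form is a nonzero real multiple of a form with rational coefficients; for irrational forms they can fail even if both Ehrhart series are rational functions. Part (1) is proved for all real forms. *)

theory Defs
  imports "HOL-Analysis.Analysis" "HOL-Computational_Algebra.Formal_Laurent_Series"
begin

no_notation fps_nth (infixl \<open>$\<close> 75)

definition lattice_points :: "(real ^ 'n) set" where
  "lattice_points = {x. \<forall>j. x $ j \<in> \<int>}"

definition closed_cone :: "nat \<Rightarrow> (nat \<Rightarrow> real ^ 'n \<Rightarrow> real) \<Rightarrow> (real ^ 'n) set" where
  "closed_cone m lam = {x. (\<forall>j. 0 \<le> x $ j) \<and> (\<forall>i\<in>{1..m}. 0 \<le> lam i x)}"

definition semiopen_cone :: "nat \<Rightarrow> (nat \<Rightarrow> real ^ 'n \<Rightarrow> real) \<Rightarrow> (real ^ 'n) set" where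
  "semiopen_cone m lam = {x. (\<forall>j. 0 \<le> x $ j) \<and> (\<forall>i\<in>{1..m}. 0 < lam i x)}"

definition semiopen_polytope :: "nat \<Rightarrow> (nat \<Rightarrow> real ^ 'n \<Rightarrow> real) \<Rightarrow> (real ^ 'n) set" where
  "semiopen_polytope m lam = {x \<in> semiopen_cone m lam. (\<Sum>j\<in>UNIV. x $ j) = 1}"

text \<open>
  A linear form is rational if its kernel is a rational hyperplane (or everything), i.e. if it is
  proportional to a form with rational coefficients.  Without this condition the Ehrhart series
  below need not be rational functions, and Ehrhart reciprocity may fail even if they are.
\<close>

definition rational_form :: "(real ^ 'n \<Rightarrow> real) \<Rightarrow> bool" where
  "rational_form l \<longleftrightarrow> (\<exists>c. c \<noteq> 0 \<and> (\<forall>j. c * l (axis j 1) \<in> \<rat>))"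

text \<open>
  The value at \<open>k\<close> is the number of lattice points of degree \<open>k\<close> in the cone over \<open>Q\<close>.  For
  \<open>k > 0\<close> these are the lattice points of the dilate of \<open>Q\<close>.  For \<open>k = 0\<close> the only candidate is the
  origin.  It belongs to the cone over a polytope, but removing a facet of the polytope removes the
  apex of the cone as well; so it is counted precisely if \<open>Q\<close> is nonempty and closed.  The lemmas
  \<open>ehrhart_semiopen_polytope\<close> and \<open>ehrhart_closure_semiopen_polytope\<close> below give the descriptions
  by the cones.
\<close>

definition ehrhart :: "(real ^ 'n) set \<Rightarrow> nat \<Rightarrow> nat" where
  "ehrhart Q k =
     (if k = 0 then (if Q \<noteq> {} \<and> closed Q then 1 else 0)
      else card ((\<lambda>x. real k *\<^sub>R x) ` Q \<inter> lattice_points))"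

text \<open>
  All identities of rational functions are stated in the field of formal Laurent series over the
  rationals, into which the field of rational functions embeds by expansion at \<open>0\<close>.  The
  indeterminate \<open>t\<close> is \<open>fls_X\<close>.
\<close>

definition ehrhart_series :: "(real ^ 'n) set \<Rightarrow> rat fls" where
  "ehrhart_series Q = fps_to_fls (Abs_fps (\<lambda>k. of_nat (ehrhart Q k)))"

text \<open>
  The value of the rational function \<open>p/q\<close> at a Laurent series \<open>z\<close>.  It is used for \<open>z = t\<close>
  and \<open>z = 1/t\<close>; both are transcendental over the rationals, so that the denominator does not vanish
  if \<open>q \<noteq> 0\<close>, and the value at \<open>t\<close> determines the value at \<open>1/t\<close>.
\<close>

definition ratfun :: "rat poly \<Rightarrow> rat poly \<Rightarrow> rat fls \<Rightarrow> rat fls" where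
  "ratfun p q z = poly (map_poly fls_const p) z / poly (map_poly fls_const q) z"

lemma semiopen_polytope_scale:
  fixes lam :: "nat \<Rightarrow> real ^ 'n \<Rightarrow> real"
  assumes lin: "\<And>i. i \<in> {1..m} \<Longrightarrow> linear (lam i)" and k: "0 < (k::real)"
  shows "(\<lambda>x. k *\<^sub>R x) ` semiopen_polytope m lam
           = {x \<in> semiopen_cone m lam. (\<Sum>j\<in>UNIV. x $ j) = k}"
    (is "?L = ?R")
proof (intro equalityI subsetI)
  fix y assume "y \<in> ?L"
  then show "y \<in> ?R"
    using k lin by (auto simp: semiopen_polytope_def semiopen_cone_def linear_cmul
                           sum_distrib_left[symmetric])
next
  fix y assume y: "y \<in> ?R"
  have "(1 / k) *\<^sub>R y \<in> semiopen_polytope m lam"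
    using y k lin by (auto simp: semiopen_polytope_def semiopen_cone_def linear_cmul
                           sum_divide_distrib[symmetric])
  moreover have "y = k *\<^sub>R ((1 / k) *\<^sub>R y)" using k by simp
  ultimately show "y \<in> ?L" by (rule rev_image_eqI)
qed

lemma closure_semiopen_polytope:
  fixes lam :: "nat \<Rightarrow> real ^ 'n \<Rightarrow> real"
  assumes lin: "\<And>i. i \<in> {1..m} \<Longrightarrow> linear (lam i)"
    and ne: "semiopen_polytope m lam \<noteq> {}"
  shows "closure (semiopen_polytope m lam) = {x \<in> closed_cone m lam. (\<Sum>j\<in>UNIV. x $ j) = 1}"
    (is "?L = ?R")
proof
  have cont: "continuous_on UNIV (lam i)" if "i \<in> {1..m}" for i
    using lin[OF that] by (simp add: linear_continuous_on linear_conv_bounded_linear)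
  have "?R = (\<Inter>j. {x. 0 \<le> x $ j}) \<inter> (\<Inter>i\<in>{1..m}. {x. 0 \<le> lam i x})
              \<inter> {x. (\<Sum>j\<in>UNIV. x $ j) = 1}"
    by (auto simp: closed_cone_def)
  moreover have "closed \<dots>"
    by (intro closed_Int closed_INT ballI closed_Collect_le closed_Collect_eq continuous_intros
          cont) auto
  ultimately have "closed ?R" by simp
  moreover have "semiopen_polytope m lam \<subseteq> ?R"
    by (auto simp: semiopen_polytope_def semiopen_cone_def closed_cone_def less_imp_le)
  ultimately show "?L \<subseteq> ?R" by (rule closure_minimal[rotated])
next
  obtain p where p: "p \<in> semiopen_polytope m lam" using ne by blast
  show "?R \<subseteq> ?L"
  proof
    fix x assume x: "x \<in> ?R"
    define f where "f n = x + (1 / real (Suc n)) *\<^sub>R (p - x)" for n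
    have "f n \<in> semiopen_polytope m lam" for n
    proof -
      define u where "u = 1 / real (Suc n)"
      have u: "0 < u" "u \<le> 1" by (auto simp: u_def)
      have f: "f n = (1 - u) *\<^sub>R x + u *\<^sub>R p"
        by (simp add: f_def u_def algebra_simps)
      have "lam i (f n) = (1 - u) * lam i x + u * lam i p" if "i \<in> {1..m}" for i
        using lin[OF that] by (simp add: f linear_add linear_cmul)
      moreover have "(\<Sum>j\<in>UNIV. f n $ j) = (1 - u) * (\<Sum>j\<in>UNIV. x $ j) + u * (\<Sum>j\<in>UNIV. p $ j)"
        by (simp add: f sum.distrib sum_distrib_left)
      ultimately show ?thesis
        using x p u
        by (auto simp: semiopen_polytope_def semiopen_cone_def closed_cone_def f
            intro!: add_nonneg_pos)
    qed
    moreover have "f \<longlonglongrightarrow> x + 0 *\<^sub>R (p - x)"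
      unfolding f_def by (intro tendsto_intros LIMSEQ_Suc[OF lim_1_over_n])
    ultimately show "x \<in> ?L" by (auto simp: closure_sequential)
  qed
qed

lemma closed_cone_section_scale:
  fixes lam :: "nat \<Rightarrow> real ^ 'n \<Rightarrow> real"
  assumes lin: "\<And>i. i \<in> {1..m} \<Longrightarrow> linear (lam i)" and k: "0 < (k::real)"
  shows "(\<lambda>x. k *\<^sub>R x) ` {x \<in> closed_cone m lam. (\<Sum>j\<in>UNIV. x $ j) = 1}
           = {x \<in> closed_cone m lam. (\<Sum>j\<in>UNIV. x $ j) = k}"
    (is "?L = ?R")
proof (intro equalityI subsetI)
  fix y assume "y \<in> ?L"
  then show "y \<in> ?R"
    using k lin by (auto simp: closed_cone_def linear_cmul sum_distrib_left[symmetric])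
next
  fix y assume y: "y \<in> ?R"
  have "(1 / k) *\<^sub>R y \<in> {x \<in> closed_cone m lam. (\<Sum>j\<in>UNIV. x $ j) = 1}"
    using y k lin by (auto simp: closed_cone_def linear_cmul sum_divide_distrib[symmetric])
  moreover have "y = k *\<^sub>R ((1 / k) *\<^sub>R y)" using k by simp
  ultimately show "y \<in> ?L" by (rule rev_image_eqI)
qed

lemma nonneg_sum_zero_iff:
  fixes x :: "real ^ 'n"
  shows "(\<forall>j. 0 \<le> x $ j) \<and> (\<Sum>j\<in>UNIV. x $ j) = 0 \<longleftrightarrow> x = 0"
  by (auto simp: vec_eq_iff sum_nonneg_eq_0_iff)

lemma ehrhart_closure_semiopen_polytope:
  fixes lam :: "nat \<Rightarrow> real ^ 'n \<Rightarrow> real"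
  assumes lin: "\<And>i. i \<in> {1..m} \<Longrightarrow> linear (lam i)"
    and ne: "semiopen_polytope m lam \<noteq> {}"
  shows "ehrhart (closure (semiopen_polytope m lam)) k
           = card {x \<in> closed_cone m lam \<inter> lattice_points. (\<Sum>j\<in>UNIV. x $ j) = real k}"
proof (cases "k = 0")
  case True
  have "{x \<in> closed_cone m lam \<inter> lattice_points. (\<Sum>j\<in>UNIV. x $ j) = real k} = {0}"
    using True lin nonneg_sum_zero_iff
    by (auto simp: closed_cone_def lattice_points_def linear_0)
  then show ?thesis using True ne by (simp add: ehrhart_def)
next
  case False
  then have "(\<lambda>x. real k *\<^sub>R x) ` closure (semiopen_polytope m lam) \<inter> lattice_points
      = {x \<in> closed_cone m lam \<inter> lattice_points. (\<Sum>j\<in>UNIV. x $ j) = real k}"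
    using closed_cone_section_scale[of m lam "real k"] lin closure_semiopen_polytope[OF lin ne]
    by auto
  then show ?thesis using False by (simp add: ehrhart_def)
qed

lemma ehrhart_semiopen_polytope:
  fixes lam :: "nat \<Rightarrow> real ^ 'n \<Rightarrow> real"
  assumes lin: "\<And>i. i \<in> {1..m} \<Longrightarrow> linear (lam i)"
    and one: "\<And>i. i \<in> {1..m} \<Longrightarrow> lam i 1 = 0"
    and ne: "semiopen_polytope m lam \<noteq> {}"
  shows "ehrhart (semiopen_polytope m lam) k
           = card {x \<in> semiopen_cone m lam \<inter> lattice_points. (\<Sum>j\<in>UNIV. x $ j) = real k}"
proof (cases "k = 0")
  case True
  define b :: "real ^ 'n" where "b = (1 / real CARD('n)) *\<^sub>R 1"
  have eq: "{x \<in> semiopen_cone m lam \<inter> lattice_points. (\<Sum>j\<in>UNIV. x $ j) = real k}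
          = (if m = 0 then {0} else {})"
  proof -
    have "m = 0" if z: "0 \<in> semiopen_cone m lam"
    proof (rule ccontr)
      assume "m \<noteq> 0"
      then have i: "1 \<in> {1..m}" by simp
      then have "0 < lam 1 0" using z by (simp add: semiopen_cone_def)
      then show False using linear_0[OF lin[OF i]] by simp
    qed
    moreover have "0 \<in> semiopen_cone m lam" if "m = 0"
      using that by (simp add: semiopen_cone_def)
    moreover have "x = 0" if "x \<in> semiopen_cone m lam" "(\<Sum>j\<in>UNIV. x $ j) = 0" for x
      using nonneg_sum_zero_iff[of x] that by (simp add: semiopen_cone_def)
    moreover have "(0 :: real ^ 'n) \<in> lattice_points" by (simp add: lattice_points_def)
    ultimately show ?thesis using True by auto
  qed
  have "closed (semiopen_polytope m lam) \<longleftrightarrow> m = 0"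
  proof
    assume cl: "closed (semiopen_polytope m lam)"
    have "b \<in> closure (semiopen_polytope m lam)"
      using lin one
      by (subst closure_semiopen_polytope[OF lin ne])
         (auto simp: b_def closed_cone_def linear_cmul)
    then have "b \<in> semiopen_polytope m lam" using cl by simp
    then have "\<forall>i\<in>{1..m}. 0 < lam i b" by (simp add: semiopen_polytope_def semiopen_cone_def)
    then show "m = 0" using lin one by (force simp: b_def linear_cmul)
  next
    assume "m = 0"
    then have "semiopen_polytope m lam = closure (semiopen_polytope m lam)"
      using closure_semiopen_polytope[OF lin ne]
      by (simp add: semiopen_polytope_def semiopen_cone_def closed_cone_def)
    then show "closed (semiopen_polytope m lam)" by (metis closed_closure)
  qed
  then show ?thesis using True ne eq by (simp add: ehrhart_def)
next
  case False
  then have "(\<lambda>x. real k *\<^sub>R x) ` semiopen_polytope m lam \<inter> lattice_points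
      = {x \<in> semiopen_cone m lam \<inter> lattice_points. (\<Sum>j\<in>UNIV. x $ j) = real k}"
    using semiopen_polytope_scale[of m lam "real k"] lin by auto
  then show ?thesis using False by (simp add: ehrhart_def)
qed

end

theory Submission
  imports Defs
begin

text \<open>
  The lattice points of the interior of the cone \<open>C\<close> are the translates by \<open>1\<close> of those of \<open>D\<close>,
  since the forms vanish on \<open>1\<close> and an integer is positive iff it is at least \<open>1\<close>.  Everything else
  is Stanley reciprocity for \<open>C\<close>.  Cutting the orthant by one half-space after another and
  subdividing stellarly writes \<open>C\<close>, off finitely many hyperplanes, as a disjoint union of
  simplicial cones.  Moving every point by a small multiple of a generic interior direction \<open>u\<close> turns
  this into an exact decomposition of \<open>C\<close> into half-open simplicial cones, and moving by \<open>-u\<close> into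
  one of the interior of \<open>C\<close> into the same cones with the complementary facets removed.  The
  generating function of a half-open simplicial cone is that of its fundamental box divided by
  \<open>\<Prod>(1 - t^g\<^sub>i)\<close>, and the central reflection of the box exchanges the two kinds of facets.
\<close>

subsection \<open>Triangulation off finitely many hyperplanes\<close>

text \<open>The exceptional set is a finite union of linear hyperplanes with normals in
  \<open>H\<close>. A zero normal would exclude every point and make the notion void.\<close>

definition generically :: "(real ^ 'n \<Rightarrow> bool) \<Rightarrow> bool" where
  "generically P \<longleftrightarrow> (\<exists>H. finite H \<and> 0 \<notin> H \<and> (\<forall>x. (\<forall>h\<in>H. h \<bullet> x \<noteq> 0) \<longrightarrow> P x))"

lemma generically_always: "(\<And>x. P x) \<Longrightarrow> generically P"
  unfolding generically_def by (intro exI[of _ "{}"]) auto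

lemma generically_nonzero:
  assumes "finite H" "0 \<notin> H"
  shows "generically (\<lambda>x. \<forall>h\<in>H. h \<bullet> x \<noteq> 0)"
  unfolding generically_def using assms by blast

lemma generically_conj:
  assumes "generically P" "generically Q"
  shows "generically (\<lambda>x. P x \<and> Q x)"
proof -
  obtain H where H: "finite H" "0 \<notin> H" "\<And>x. \<forall>h\<in>H. h \<bullet> x \<noteq> 0 \<Longrightarrow> P x"
    using assms(1) unfolding generically_def by blast
  obtain G where G: "finite G" "0 \<notin> G" "\<And>x. \<forall>h\<in>G. h \<bullet> x \<noteq> 0 \<Longrightarrow> Q x"
    using assms(2) unfolding generically_def by blast
  show ?thesis
    unfolding generically_def using H G by (intro exI[of _ "H \<union> G"]) auto
qed

lemma generically_mono:
  assumes "generically P" "\<And>x. P x \<Longrightarrow> Q x"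
  shows "generically Q"
  using assms unfolding generically_def by blast

text \<open>Only the direction \<open>u\<close> is generic; the base point \<open>x\<close> is
  arbitrary and may lie on exceptional hyperplanes. If h is not orthogonal to \<open>u\<close>, then
  the affine function e -> h . (x + e u) has a single zero, which small positive e avoid.\<close>

lemma generically_eventually_ray:
  assumes "generically P"
  shows "generically (\<lambda>u. \<forall>x. \<forall>\<^sub>F e in at_right 0. P (x + e *\<^sub>R u) \<and> P (x + e *\<^sub>R (- u)))"
proof -
  obtain H where H: "finite H" "0 \<notin> H" "\<And>x. \<forall>h\<in>H. h \<bullet> x \<noteq> 0 \<Longrightarrow> P x"
    using assms unfolding generically_def by blast
  have ev: "\<forall>\<^sub>F e in at_right 0. P (x + e *\<^sub>R u)" if u: "\<forall>h\<in>H. h \<bullet> u \<noteq> 0" for x u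
  proof -
    have "\<forall>\<^sub>F e in at_right 0. h \<bullet> (x + e *\<^sub>R u) \<noteq> 0" if "h \<in> H" for h
    proof -
      have "h \<bullet> (x + e *\<^sub>R u) = 0 \<longleftrightarrow> e = - (h \<bullet> x) / (h \<bullet> u)" for e
        using u that by (auto simp: inner_add_right field_simps eq_neg_iff_add_eq_0)
      moreover have "\<forall>\<^sub>F e in at_right 0. e \<noteq> - (h \<bullet> x) / (h \<bullet> u)"
        by (rule eventually_neq_at_within)
      ultimately show ?thesis by simp
    qed
    then have "\<forall>\<^sub>F e in at_right 0. \<forall>h\<in>H. h \<bullet> (x + e *\<^sub>R u) \<noteq> 0"
      using H(1) by (simp add: eventually_ball_finite)
    then show ?thesis by (rule eventually_mono) (use H(3) in blast)
  qed
  have "\<forall>\<^sub>F e in at_right 0. P (x + e *\<^sub>R u) \<and> P (x + e *\<^sub>R (- u))"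
    if "\<forall>h\<in>H. h \<bullet> u \<noteq> 0" for x u
    using that by (intro eventually_conj ev) auto
  then show ?thesis unfolding generically_def using H(1,2) by blast
qed

text \<open>Hyperplanes are null sets, and a nonempty open set is not covered by finitely many of
  them.\<close>

lemma generically_ex_open:
  assumes "generically P" "open U" "U \<noteq> {}"
  shows "\<exists>x\<in>U. P x"
proof -
  obtain H where H: "finite H" "0 \<notin> H" "\<And>x. \<forall>h\<in>H. h \<bullet> x \<noteq> 0 \<Longrightarrow> P x"
    using assms(1) unfolding generically_def by blast
  have "negligible (\<Union>h\<in>H. {x. h \<bullet> x = 0})"
    using H(1,2) by (intro negligible_Union) (auto intro!: negligible_hyperplane)
  then have "\<not> U \<subseteq> (\<Union>h\<in>H. {x. h \<bullet> x = 0})"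
    using assms(2,3) open_not_negligible negligible_subset by blast
  then show ?thesis using H(3) by blast
qed

text \<open>A simplicial cone is carried as a pair: \<open>v\<close> are its generators and
  \<open>c\<close> its inner facet normals. The number \<open>c i \<bullet> x\<close> is the
  coordinate of \<open>x\<close> at \<open>v i\<close>, so the cone is where all of these are
  nonnegative.\<close>

definition dual_bases :: "('n \<Rightarrow> real ^ 'n) \<Rightarrow> ('n \<Rightarrow> real ^ 'n) \<Rightarrow> bool" where
  "dual_bases v c \<longleftrightarrow> (\<forall>i j. c i \<bullet> v j = of_bool (i = j))
     \<and> (\<forall>x. x = (\<Sum>i\<in>UNIV. (c i \<bullet> x) *\<^sub>R v i))"

definition orthant_lattice_vector :: "real ^ 'n \<Rightarrow> bool" where
  "orthant_lattice_vector x \<longleftrightarrow> x \<in> lattice_points \<and> (\<forall>j. 0 \<le> x $ j)"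

text \<open>Values in the natural numbers make the notion additive. When \<open>f\<close> is an
  indicator, the identity says that the cones in \<open>L\<close> cover its set and overlap only
  inside the exceptional hyperplanes.\<close>

definition triangulable :: "(real ^ 'n \<Rightarrow> nat) \<Rightarrow> bool" where
  "triangulable f \<longleftrightarrow> (\<exists>L. (\<forall>(v, c)\<in>set L. dual_bases v c \<and> (\<forall>i. orthant_lattice_vector (v i)))
     \<and> generically (\<lambda>x. f x = (\<Sum>(v, c)\<leftarrow>L. of_bool (\<forall>i. 0 \<le> c i \<bullet> x))))"

lemma triangulable_cone:
  assumes "dual_bases v c" "\<And>i. orthant_lattice_vector (v i)"
  shows "triangulable (\<lambda>x. of_bool (\<forall>i. 0 \<le> c i \<bullet> x))"
  unfolding triangulable_def using assms
  by (intro exI[of _ "[(v, c)]"]) (auto intro: generically_always)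

lemma triangulable_add:
  assumes "triangulable f" "triangulable g" "generically (\<lambda>x. F x = f x + g x)"
  shows "triangulable F"
proof -
  obtain L where L: "\<forall>(v, c)\<in>set L. dual_bases v c \<and> (\<forall>i. orthant_lattice_vector (v i))"
      "generically (\<lambda>x. f x = (\<Sum>(v, c)\<leftarrow>L. of_bool (\<forall>i. 0 \<le> c i \<bullet> x)))"
    using assms(1) unfolding triangulable_def by blast
  obtain M where M: "\<forall>(v, c)\<in>set M. dual_bases v c \<and> (\<forall>i. orthant_lattice_vector (v i))"
      "generically (\<lambda>x. g x = (\<Sum>(v, c)\<leftarrow>M. of_bool (\<forall>i. 0 \<le> c i \<bullet> x)))"
    using assms(2) unfolding triangulable_def by blast
  have "generically (\<lambda>x. F x = (\<Sum>(v, c)\<leftarrow>L @ M. of_bool (\<forall>i. 0 \<le> c i \<bullet> x)))"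
    by (rule generically_mono[OF generically_conj[OF assms(3) generically_conj[OF L(2) M(2)]]]) simp
  then show ?thesis
    unfolding triangulable_def using L(1) M(1) by (intro exI[of _ "L @ M"]) auto
qed

lemma triangulable_zero:
  assumes "generically (\<lambda>x. f x = 0)"
  shows "triangulable f"
  unfolding triangulable_def using assms by (intro exI[of _ "[]"]) auto

lemma inner_in_Ints:
  assumes "x \<in> lattice_points" "y \<in> lattice_points"
  shows "x \<bullet> y \<in> \<int>"
  using assms by (auto simp: inner_vec_def lattice_points_def intro!: Ints_sum Ints_mult)

lemma dual_bases_inner:
  assumes "dual_bases v c"
  shows "l \<bullet> x = (\<Sum>i\<in>UNIV. (c i \<bullet> x) * (l \<bullet> v i))"
proof -
  have "l \<bullet> x = l \<bullet> (\<Sum>i\<in>UNIV. (c i \<bullet> x) *\<^sub>R v i)"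
    using assms unfolding dual_bases_def by metis
  then show ?thesis by (simp add: inner_sum_right)
qed

text \<open>The stellar subdivision of a simplicial cone at a point \<open>a v\<^sub>n + b v\<^sub>p\<close> of an edge.\<close>

lemma dual_bases_subdivide:
  assumes "dual_bases v c" "p \<noteq> n" "a \<noteq> 0"
  shows "dual_bases (v(n := a *\<^sub>R v n + b *\<^sub>R v p))
           (c(n := (1 / a) *\<^sub>R c n, p := c p - (b / a) *\<^sub>R c n))"
    (is "dual_bases ?v ?c")
  unfolding dual_bases_def
proof (intro conjI allI)
  have cv: "c i \<bullet> v j = of_bool (i = j)" for i j using assms(1) unfolding dual_bases_def by blast
  show "?c i \<bullet> ?v j = of_bool (i = j)" for i j
    using assms(2,3) by (auto simp: inner_add_right inner_diff_left cv)
  fix x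
  have x: "x = (\<Sum>i\<in>UNIV. (c i \<bullet> x) *\<^sub>R v i)" using assms(1) unfolding dual_bases_def by blast
  have split: "(\<Sum>i\<in>UNIV. f i) = f n + f p + (\<Sum>i\<in>UNIV - {n, p}. f i)" for f :: "'a \<Rightarrow> real ^ 'a"
    using assms(2) by (simp add: sum.subset_diff[of "{n, p}" UNIV])
  have "(\<Sum>i\<in>UNIV. (?c i \<bullet> x) *\<^sub>R ?v i)
      = (1 / a * (c n \<bullet> x)) *\<^sub>R (a *\<^sub>R v n + b *\<^sub>R v p) + (c p \<bullet> x - b / a * (c n \<bullet> x)) *\<^sub>R v p
        + (\<Sum>i\<in>UNIV - {n, p}. (c i \<bullet> x) *\<^sub>R v i)"
    unfolding split using assms(2) by (auto simp: inner_diff_left intro!: sum.cong)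
  also have "\<dots> = (c n \<bullet> x) *\<^sub>R v n + (c p \<bullet> x) *\<^sub>R v p + (\<Sum>i\<in>UNIV - {n, p}. (c i \<bullet> x) *\<^sub>R v i)"
    using assms(3) by (simp add: scaleR_add_right scaleR_diff_left)
  also have "\<dots> = x" using x unfolding split by (rule sym)
  finally show "x = (\<Sum>i\<in>UNIV. (?c i \<bullet> x) *\<^sub>R ?v i)" by simp
qed

lemma dual_bases_nonzero:
  assumes "dual_bases v c"
  shows "c i \<noteq> 0"
proof
  assume "c i = 0"
  moreover have "c i \<bullet> v i = 1" using assms unfolding dual_bases_def by simp
  ultimately show False by simp
qed

text \<open>Each subdivision at the hyperplane \<open>l = 0\<close> lowers the number of generators off it.\<close>

lemma triangulable_cone_halfspace:
  fixes l :: "real ^ 'n"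
  assumes "dual_bases v c" "\<And>i. orthant_lattice_vector (v i)" "l \<in> lattice_points"
  shows "triangulable (\<lambda>x. of_bool (\<forall>i. 0 \<le> c i \<bullet> x) * of_bool (0 \<le> l \<bullet> x))"
  using assms(1,2)
proof (induction "card {i. l \<bullet> v i \<noteq> 0}" arbitrary: v c rule: less_induct)
  case less
  note db = less.prems(1) and ol = less.prems(2)
  consider "\<forall>i. 0 \<le> l \<bullet> v i" | "\<forall>i. l \<bullet> v i \<le> 0" "\<exists>i. l \<bullet> v i < 0"
    | "\<exists>i. l \<bullet> v i < 0" "\<exists>i. l \<bullet> v i > 0"
    by (meson linorder_not_less)
  then show ?case
  proof cases
    case 1
    have "0 \<le> l \<bullet> x" if "\<forall>i. 0 \<le> c i \<bullet> x" for x
      unfolding dual_bases_inner[OF db, of l x] using 1 that by (intro sum_nonneg) auto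
    then have "(\<lambda>x. of_bool (\<forall>i. 0 \<le> c i \<bullet> x) * of_bool (0 \<le> l \<bullet> x) :: nat)
        = (\<lambda>x. of_bool (\<forall>i. 0 \<le> c i \<bullet> x))"
      by fastforce
    then show ?thesis using triangulable_cone[OF db ol] by simp
  next
    case 2
    then obtain n where n: "l \<bullet> v n < 0" by blast
    \<comment> \<open>The closed cone may still meet \<open>l = 0\<close> in a proper face. Off its
      facet hyperplanes all coordinates are strictly positive, and the generator \<open>v n\<close>
      makes the sum negative.\<close>
    have neg: "l \<bullet> x < 0" if x: "\<forall>i. 0 \<le> c i \<bullet> x" "\<forall>h\<in>range c. h \<bullet> x \<noteq> 0" for x
    proof -
      have pos: "0 < c i \<bullet> x" for i using x by (metis order_le_less rangeI)
      have "(\<Sum>i\<in>UNIV. (c i \<bullet> x) * (l \<bullet> v i)) < (\<Sum>i\<in>(UNIV :: 'n set). 0)"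
        using 2(1) n pos
        by (intro sum_strict_mono_ex1) (auto simp: mult_le_0_iff mult_less_0_iff less_imp_le)
      then show ?thesis using dual_bases_inner[OF db, of l x] by simp
    qed
    then have *: "of_bool (\<forall>i. 0 \<le> c i \<bullet> x) * of_bool (0 \<le> l \<bullet> x) = (0 :: nat)"
      if "\<forall>h\<in>range c. h \<bullet> x \<noteq> 0" for x
    proof -
      have "\<not> (\<forall>i. 0 \<le> c i \<bullet> x) \<or> \<not> 0 \<le> l \<bullet> x" using neg[of x] that by (meson not_le)
      then show ?thesis by (elim disjE) simp_all
    qed
    have "0 \<notin> range c" using dual_bases_nonzero[OF db] by (metis rangeE)
    then have "generically (\<lambda>x. \<forall>h\<in>range c. h \<bullet> x \<noteq> 0)"
      by (intro generically_nonzero finite_imageI finite)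
    then show ?thesis by (rule triangulable_zero[OF generically_mono]) (rule *)
  next
    case 3
    then obtain n p where n: "l \<bullet> v n < 0" and p: "l \<bullet> v p > 0" by blast
    then have pn: "p \<noteq> n" by auto
    \<comment> \<open>The weights are the absolute values of \<open>l\<close> at the opposite
      generator, so that \<open>w\<close> lies on \<open>l = 0\<close>. They are positive integers,
      which keeps \<open>w\<close> a lattice vector of the orthant.\<close>
    define a where "a = l \<bullet> v p"
    define b where "b = - (l \<bullet> v n)"
    have ab: "0 < a" "0 < b" using n p by (auto simp: a_def b_def)
    define w where "w = a *\<^sub>R v n + b *\<^sub>R v p"
    have lw: "l \<bullet> w = 0" by (simp add: w_def a_def b_def inner_diff_right)
    have "a \<in> \<int>" "b \<in> \<int>"
      using assms(3) ol by (auto simp: a_def b_def orthant_lattice_vector_def intro!: inner_in_Ints)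
    then have w: "orthant_lattice_vector w"
      using ol[of n] ol[of p] ab
      by (auto simp: w_def orthant_lattice_vector_def lattice_points_def)
    define v1 where "v1 = v(n := w)"
    define c1 where "c1 = c(n := (1 / a) *\<^sub>R c n, p := c p - (b / a) *\<^sub>R c n)"
    define v2 where "v2 = v(p := w)"
    define c2 where "c2 = c(p := (1 / b) *\<^sub>R c p, n := c n - (a / b) *\<^sub>R c p)"
    have db1: "dual_bases v1 c1"
      unfolding v1_def c1_def w_def using dual_bases_subdivide[OF db pn] ab by simp
    have "dual_bases (v(p := b *\<^sub>R v p + a *\<^sub>R v n)) c2"
      unfolding c2_def using dual_bases_subdivide[OF db pn[symmetric]] ab by simp
    then have db2: "dual_bases v2 c2" unfolding v2_def w_def by (simp add: add.commute)
    have "card {i. l \<bullet> v1 i \<noteq> 0} < card {i. l \<bullet> v i \<noteq> 0}"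
    proof (rule psubset_card_mono)
      have "{i. l \<bullet> v1 i \<noteq> 0} \<subseteq> {i. l \<bullet> v i \<noteq> 0}" using n lw by (simp add: v1_def Collect_mono)
      moreover have "n \<in> {i. l \<bullet> v i \<noteq> 0}" "n \<notin> {i. l \<bullet> v1 i \<noteq> 0}"
        using n lw by (simp_all add: v1_def)
      ultimately show "{i. l \<bullet> v1 i \<noteq> 0} \<subset> {i. l \<bullet> v i \<noteq> 0}" by blast
    qed simp
    then have t1: "triangulable (\<lambda>x. of_bool (\<forall>i. 0 \<le> c1 i \<bullet> x) * of_bool (0 \<le> l \<bullet> x))"
      using less.hyps[OF _ db1] ol w by (simp add: v1_def)
    have "card {i. l \<bullet> v2 i \<noteq> 0} < card {i. l \<bullet> v i \<noteq> 0}"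
    proof (rule psubset_card_mono)
      have "{i. l \<bullet> v2 i \<noteq> 0} \<subseteq> {i. l \<bullet> v i \<noteq> 0}" using p lw by (simp add: v2_def Collect_mono)
      moreover have "p \<in> {i. l \<bullet> v i \<noteq> 0}" "p \<notin> {i. l \<bullet> v2 i \<noteq> 0}"
        using p lw by (simp_all add: v2_def)
      ultimately show "{i. l \<bullet> v2 i \<noteq> 0} \<subset> {i. l \<bullet> v i \<noteq> 0}" by blast
    qed simp
    then have t2: "triangulable (\<lambda>x. of_bool (\<forall>i. 0 \<le> c2 i \<bullet> x) * of_bool (0 \<le> l \<bullet> x))"
      using less.hyps[OF _ db2] ol w by (simp add: v2_def)
    \<comment> \<open>\<open>c1 p\<close> is normal to the wall shared by the two pieces, which is
      spanned by \<open>w\<close> and the generators other than \<open>v n\<close> and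
      \<open>v p\<close>. Off this wall the pieces do not overlap.\<close>
    have "of_bool (\<forall>i. 0 \<le> c i \<bullet> x)
        = (of_bool (\<forall>i. 0 \<le> c1 i \<bullet> x) + of_bool (\<forall>i. 0 \<le> c2 i \<bullet> x) :: nat)"
      if x: "c1 p \<bullet> x \<noteq> 0" for x
    proof -
      have all_iff: "(\<forall>i. P i) \<longleftrightarrow> (\<forall>i. i \<noteq> n \<longrightarrow> i \<noteq> p \<longrightarrow> P i) \<and> P n \<and> P p" for P :: "'n \<Rightarrow> bool"
        by metis
      define R where "R \<longleftrightarrow> (\<forall>i. i \<noteq> n \<longrightarrow> i \<noteq> p \<longrightarrow> 0 \<le> c i \<bullet> x)"
      \<comment> \<open>With the coordinates at \<open>v n\<close> and \<open>v p\<close> rescaled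
        in this way, the wall is \<open>r = s\<close> and the two pieces are
        \<open>r \<le> s\<close> and \<open>s \<le> r\<close>.\<close>
      define r s where "r = b * (c n \<bullet> x)" and "s = a * (c p \<bullet> x)"
      have r: "0 \<le> c n \<bullet> x \<longleftrightarrow> 0 \<le> r" and s: "0 \<le> c p \<bullet> x \<longleftrightarrow> 0 \<le> s"
        using ab by (simp_all add: r_def s_def zero_le_mult_iff)
      define e where "e = a * b"
      have e: "0 < e" using ab by (simp add: e_def)
      have "c1 n \<bullet> x = r / e" "c1 p \<bullet> x = (s - r) / a"
          "c2 p \<bullet> x = s / e" "c2 n \<bullet> x = (r - s) / b"
        using ab pn by (auto simp: c1_def c2_def r_def s_def e_def inner_diff_left field_simps)
      then have c12: "0 \<le> c1 n \<bullet> x \<longleftrightarrow> 0 \<le> r" "0 \<le> c1 p \<bullet> x \<longleftrightarrow> r \<le> s" "r \<noteq> s"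
          "0 \<le> c2 p \<bullet> x \<longleftrightarrow> 0 \<le> s" "0 \<le> c2 n \<bullet> x \<longleftrightarrow> s \<le> r"
        using x ab e by (auto simp: zero_le_divide_iff)
      have "(\<forall>i. 0 \<le> c i \<bullet> x) \<longleftrightarrow> R \<and> 0 \<le> r \<and> 0 \<le> s"
        unfolding all_iff[of "\<lambda>i. 0 \<le> c i \<bullet> x"] R_def r s by (rule refl)
      moreover have "(\<forall>i. 0 \<le> c1 i \<bullet> x) \<longleftrightarrow> R \<and> 0 \<le> r \<and> r \<le> s"
        unfolding all_iff[of "\<lambda>i. 0 \<le> c1 i \<bullet> x"] R_def c12 by (simp add: c1_def)
      moreover have "(\<forall>i. 0 \<le> c2 i \<bullet> x) \<longleftrightarrow> R \<and> s \<le> r \<and> 0 \<le> s"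
        unfolding all_iff[of "\<lambda>i. 0 \<le> c2 i \<bullet> x"] R_def c12 by (simp add: c2_def)
      ultimately show ?thesis using \<open>r \<noteq> s\<close> by (cases R) auto
    qed
    then have *: "of_bool (\<forall>i. 0 \<le> c i \<bullet> x) * of_bool (0 \<le> l \<bullet> x)
        = (of_bool (\<forall>i. 0 \<le> c1 i \<bullet> x) * of_bool (0 \<le> l \<bullet> x)
          + of_bool (\<forall>i. 0 \<le> c2 i \<bullet> x) * of_bool (0 \<le> l \<bullet> x) :: nat)"
      if "\<forall>h\<in>{c1 p}. h \<bullet> x \<noteq> 0" for x
      using that by simp
    have "generically (\<lambda>x. \<forall>h\<in>{c1 p}. h \<bullet> x \<noteq> 0)"
      using dual_bases_nonzero[OF db1, of p] by (intro generically_nonzero) auto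
    then show ?thesis by (rule triangulable_add[OF t1 t2 generically_mono]) (rule *)
  qed
qed

text \<open>The cut is additive in \<open>f\<close>, so each cone of a triangulation is cut
  separately.\<close>

lemma triangulable_halfspace:
  assumes "triangulable f" "l \<in> lattice_points"
  shows "triangulable (\<lambda>x. f x * of_bool (0 \<le> l \<bullet> x))"
proof -
  obtain L where L: "\<forall>(v, c)\<in>set L. dual_bases v c \<and> (\<forall>i. orthant_lattice_vector (v i))"
      "generically (\<lambda>x. f x = (\<Sum>(v, c)\<leftarrow>L. of_bool (\<forall>i. 0 \<le> c i \<bullet> x)))"
    using assms(1) unfolding triangulable_def by blast
  then show ?thesis
  proof (induction L arbitrary: f)
    case Nil
    show ?case
      by (rule triangulable_zero, rule generically_mono[OF Nil(2)]) simp
  next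
    case (Cons K L)
    obtain v c where K: "K = (v, c)" by (cases K)
    \<comment> \<open>The function \<open>f\<close> agrees with the sum over the list only
      generically. The induction hypothesis is therefore applied to the exact sum over the tail, for
      which the identity holds everywhere.\<close>
    define g where "g x = (\<Sum>(v, c)\<leftarrow>L. of_bool (\<forall>i. 0 \<le> c i \<bullet> x) :: nat)" for x
    have "triangulable (\<lambda>x. g x * of_bool (0 \<le> l \<bullet> x))"
      using Cons.prems(1) by (intro Cons.IH) (auto simp: g_def intro: generically_always)
    moreover have "triangulable (\<lambda>x. of_bool (\<forall>i. 0 \<le> c i \<bullet> x) * of_bool (0 \<le> l \<bullet> x))"
      using Cons.prems(1) assms(2) by (intro triangulable_cone_halfspace) (auto simp: K)
    ultimately show ?case
      by (rule triangulable_add, intro generically_mono[OF Cons.prems(2)])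
         (simp add: K g_def algebra_simps)
  qed
qed

lemma triangulable_polyhedral_cone:
  fixes W :: "(real ^ 'n) set"
  assumes "finite W" "W \<subseteq> lattice_points"
  shows "triangulable (\<lambda>x. of_bool ((\<forall>j. 0 \<le> x $ j) \<and> (\<forall>l\<in>W. 0 \<le> l \<bullet> x)))"
  using assms
proof (induction W rule: finite_induct)
  case empty
  have "dual_bases (\<lambda>i. axis i 1) (\<lambda>i::'n. axis i 1)"
    using basis_expansion[symmetric]
    by (auto simp: dual_bases_def inner_axis' simp flip: scalar_mult_eq_scaleR) (simp add: axis_def)
  moreover have "orthant_lattice_vector (axis i 1)" for i :: 'n
    by (auto simp: orthant_lattice_vector_def lattice_points_def axis_def)
  ultimately have "triangulable (\<lambda>x. of_bool (\<forall>i :: 'n. 0 \<le> axis i 1 \<bullet> x))"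
    by (rule triangulable_cone)
  then show ?case by (simp add: inner_axis')
next
  case (insert l W)
  then have "triangulable (\<lambda>x. of_bool ((\<forall>j. 0 \<le> x $ j) \<and> (\<forall>l\<in>W. 0 \<le> l \<bullet> x)) * of_bool (0 \<le> l \<bullet> x))"
    by (intro triangulable_halfspace) auto
  moreover have "(\<lambda>x. of_bool ((\<forall>j. 0 \<le> x $ j) \<and> (\<forall>l\<in>W. 0 \<le> l \<bullet> x)) * of_bool (0 \<le> l \<bullet> x))
      = (\<lambda>x. of_bool ((\<forall>j. 0 \<le> x $ j) \<and> (\<forall>k\<in>insert l W. 0 \<le> k \<bullet> x)) :: nat)"
    by auto
  ultimately show ?case by simp
qed

subsection \<open>Half-open decompositions\<close>

text \<open>\<open>S\<close> indexes the facets that are kept, so \<open>S\<close> and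
  \<open>- S\<close> give the two cones that reciprocity exchanges.\<close>

definition half_open_cone :: "('n \<Rightarrow> real ^ 'n) \<Rightarrow> 'n set \<Rightarrow> (real ^ 'n) set" where
  "half_open_cone c S = {x. \<forall>i. if i \<in> S then 0 \<le> c i \<bullet> x else 0 < c i \<bullet> x}"

text \<open>A nonzero sign at \<open>x\<close> survives small displacements. On the hyperplane
  itself the sign of \<open>l \<bullet> u\<close> decides.\<close>

lemma eventually_ray_halfspace:
  assumes "l \<bullet> u \<noteq> 0"
  shows "\<forall>\<^sub>F e in at_right 0. 0 \<le> l \<bullet> (x + e *\<^sub>R u) \<longleftrightarrow> (if 0 < l \<bullet> u then 0 \<le> l \<bullet> x else 0 < l \<bullet> x)"
proof -
  have lim: "((\<lambda>e. l \<bullet> (x + e *\<^sub>R u)) \<longlongrightarrow> l \<bullet> (x + 0 *\<^sub>R u)) (at_right 0)"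
    by (intro tendsto_intros)
  consider "l \<bullet> x < 0" | "0 < l \<bullet> x" | "l \<bullet> x = 0" by linarith
  then show ?thesis
  proof cases
    case 1
    then have "\<forall>\<^sub>F e in at_right 0. l \<bullet> (x + e *\<^sub>R u) < 0"
      using order_tendstoD(2)[OF lim, of 0] by simp
    then show ?thesis by (rule eventually_mono) (use 1 in auto)
  next
    case 2
    then have "\<forall>\<^sub>F e in at_right 0. 0 < l \<bullet> (x + e *\<^sub>R u)"
      using order_tendstoD(1)[OF lim, of 0] by simp
    then show ?thesis by (rule eventually_mono) (use 2 in auto)
  next
    case 3
    show ?thesis
      by (rule eventually_mono[OF eventually_at_right_less])
         (use 3 assms in \<open>auto simp: inner_add_right zero_le_mult_iff\<close>)
  qed
qed

lemma eventually_ray_halfspaces: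
  assumes "finite I" "\<And>i. i \<in> I \<Longrightarrow> l i \<bullet> u \<noteq> 0"
  shows "\<forall>\<^sub>F e in at_right 0. (\<forall>i\<in>I. 0 \<le> l i \<bullet> (x + e *\<^sub>R u))
     \<longleftrightarrow> (\<forall>i\<in>I. if 0 < l i \<bullet> u then 0 \<le> l i \<bullet> x else 0 < l i \<bullet> x)"
proof -
  have "\<forall>\<^sub>F e in at_right 0. \<forall>i\<in>I. 0 \<le> l i \<bullet> (x + e *\<^sub>R u)
      \<longleftrightarrow> (if 0 < l i \<bullet> u then 0 \<le> l i \<bullet> x else 0 < l i \<bullet> x)"
    using assms by (intro eventually_ball_finite ballI eventually_ray_halfspace)
  then show ?thesis by (rule eventually_mono) blast
qed

text \<open>
  The identity of indicator functions that holds off finitely many hyperplanes is evaluated at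
  \<open>x + e u\<close> for a generic direction \<open>u\<close> and small \<open>e > 0\<close>.
\<close>

lemma half_open_identity:
  assumes W: "finite W"
    and nz: "\<forall>l\<in>W. l \<bullet> u \<noteq> 0" "\<forall>(v, c)\<in>set L. \<forall>i. c i \<bullet> u \<noteq> 0"
    and ray: "\<forall>\<^sub>F e in at_right 0. of_bool (\<forall>l\<in>W. 0 \<le> l \<bullet> (x + e *\<^sub>R u))
        = (\<Sum>(v, c)\<leftarrow>L. of_bool (\<forall>i. 0 \<le> c i \<bullet> (x + e *\<^sub>R u)) :: nat)"
  shows "of_bool (\<forall>l\<in>W. if 0 < l \<bullet> u then 0 \<le> l \<bullet> x else 0 < l \<bullet> x)
     = (\<Sum>(v, c)\<leftarrow>L. of_bool (x \<in> half_open_cone c {i. 0 < c i \<bullet> u}) :: nat)"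
proof -
  have "\<forall>\<^sub>F e in at_right 0. (\<forall>i. 0 \<le> c i \<bullet> (x + e *\<^sub>R u)) \<longleftrightarrow> x \<in> half_open_cone c {i. 0 < c i \<bullet> u}"
    if "(v, c) \<in> set L" for v c
  proof -
    have "c i \<bullet> u \<noteq> 0" for i using nz(2) that by blast
    then show ?thesis
      using eventually_ray_halfspaces[of UNIV c u x] by (simp add: half_open_cone_def)
  qed
  then have "\<forall>\<^sub>F e in at_right 0. \<forall>(v, c)\<in>set L.
      (\<forall>i. 0 \<le> c i \<bullet> (x + e *\<^sub>R u)) \<longleftrightarrow> x \<in> half_open_cone c {i. 0 < c i \<bullet> u}"
    by (intro eventually_ball_finite) auto
  moreover have "\<forall>\<^sub>F e in at_right 0. (\<forall>l\<in>W. 0 \<le> l \<bullet> (x + e *\<^sub>R u))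
      \<longleftrightarrow> (\<forall>l\<in>W. if 0 < l \<bullet> u then 0 \<le> l \<bullet> x else 0 < l \<bullet> x)"
    using eventually_ray_halfspaces[of W "\<lambda>l. l" u x] W nz(1) by blast
  \<comment> \<open>The goal does not mention \<open>e\<close>, and the filter is nontrivial; so it
    is enough to derive the goal for all small positive \<open>e\<close>.\<close>
  ultimately have "\<forall>\<^sub>F e in at_right (0 :: real). ?thesis"
    using ray
  proof eventually_elim
    case (elim e)
    have "(\<Sum>(v, c)\<leftarrow>L. of_bool (\<forall>i. 0 \<le> c i \<bullet> (x + e *\<^sub>R u)) :: nat)
        = (\<Sum>(v, c)\<leftarrow>L. of_bool (x \<in> half_open_cone c {i. 0 < c i \<bullet> u}))"
      using elim(1) by (intro arg_cong[where f = sum_list] map_cong) auto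
    then show ?case using elim(2,3) by simp
  qed
  then show ?thesis by (simp add: eventually_const)
qed

text \<open>One direction \<open>u\<close> serves both identities. All forms that define the cone
  are positive at \<open>u\<close>, so displacement by \<open>u\<close> keeps all its facets and
  displacement by \<open>-u\<close> drops all of them. A piece keeps the facets with
  \<open>c i \<bullet> u > 0\<close> in the first case and exactly the others in the second. The
  point \<open>u0\<close> shows that such directions form a nonempty open set, which then contains a
  generic one.\<close>

lemma half_open_decomposition:
  fixes W :: "(real ^ 'n) set"
  assumes W: "finite W" "W \<subseteq> lattice_points"
    and u0: "\<forall>j. 0 < u0 $ j" "\<forall>l\<in>W. 0 < l \<bullet> u0"
  obtains L where "\<forall>(v, c, S)\<in>set L. dual_bases v c \<and> (\<forall>i. orthant_lattice_vector (v i))"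
    "\<And>x. of_bool ((\<forall>j. 0 \<le> x $ j) \<and> (\<forall>l\<in>W. 0 \<le> l \<bullet> x))
       = (\<Sum>(v, c, S)\<leftarrow>L. of_bool (x \<in> half_open_cone c S) :: nat)"
    "\<And>x. of_bool ((\<forall>j. 0 < x $ j) \<and> (\<forall>l\<in>W. 0 < l \<bullet> x))
       = (\<Sum>(v, c, S)\<leftarrow>L. of_bool (x \<in> half_open_cone c (- S)) :: nat)"
proof -
  \<comment> \<open>The coordinate forms join \<open>W\<close>, so that the orthant conditions are
    treated like the other half-spaces.\<close>
  define V where "V = W \<union> range (\<lambda>j. axis j 1)"
  have V: "finite V" using W by (simp add: V_def)
  have V_closed: "(\<forall>j. 0 \<le> x $ j) \<and> (\<forall>l\<in>W. 0 \<le> l \<bullet> x) \<longleftrightarrow> (\<forall>l\<in>V. 0 \<le> l \<bullet> x)"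
    and V_open: "(\<forall>j. 0 < x $ j) \<and> (\<forall>l\<in>W. 0 < l \<bullet> x) \<longleftrightarrow> (\<forall>l\<in>V. 0 < l \<bullet> x)" for x
    by (auto simp: V_def inner_axis' ball_Un)
  obtain L where L: "\<forall>(v, c)\<in>set L. dual_bases v c \<and> (\<forall>i. orthant_lattice_vector (v i))"
      "generically (\<lambda>x. of_bool (\<forall>l\<in>V. 0 \<le> l \<bullet> x) = (\<Sum>(v, c)\<leftarrow>L. of_bool (\<forall>i. 0 \<le> c i \<bullet> x) :: nat))"
    using triangulable_polyhedral_cone[OF W] unfolding triangulable_def V_closed by blast
  define P where
    "P x \<longleftrightarrow> of_bool (\<forall>l\<in>V. 0 \<le> l \<bullet> x) = (\<Sum>(v, c)\<leftarrow>L. of_bool (\<forall>i. 0 \<le> c i \<bullet> x) :: nat)" for x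
  have "generically P" using L(2) unfolding P_def by simp
  note gP = generically_eventually_ray[OF this]
  \<comment> \<open>Genericity with respect to the facet normals of all pieces decides, for each
    facet, on which side \<open>u\<close> points.\<close>
  define H where "H = (\<Union>(v, c)\<in>set L. range c)"
  have "finite H" by (auto simp: H_def)
  moreover have "0 \<notin> H"
  proof
    assume "0 \<in> H"
    then obtain v c i where "(v, c) \<in> set L" "c i = 0" by (auto simp: H_def)
    then show False using L(1) dual_bases_nonzero[of v c i] by blast
  qed
  ultimately have gH: "generically (\<lambda>u. \<forall>h\<in>H. h \<bullet> u \<noteq> 0)" by (rule generically_nonzero)
  define U where "U = (\<Inter>l\<in>V. {x. 0 < l \<bullet> x})"
  have "open U"
    unfolding U_def using V by (intro open_INT ballI open_Collect_less continuous_intros)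
  moreover have "u0 \<in> U" using u0 V_open[of u0] by (simp add: U_def)
  then have "U \<noteq> {}" by blast
  ultimately have "\<exists>u\<in>U. (\<forall>x. \<forall>\<^sub>F e in at_right 0. P (x + e *\<^sub>R u) \<and> P (x + e *\<^sub>R (- u)))
      \<and> (\<forall>h\<in>H. h \<bullet> u \<noteq> 0)"
    by (rule generically_ex_open[OF generically_conj[OF gP gH]])
  then obtain u where uU: "u \<in> U" and
    rays: "(\<forall>x. \<forall>\<^sub>F e in at_right 0. P (x + e *\<^sub>R u) \<and> P (x + e *\<^sub>R (- u)))
      \<and> (\<forall>h\<in>H. h \<bullet> u \<noteq> 0)"
    by (rule bexE)
  note ray = rays[THEN conjunct1, THEN spec] and nzH = rays[THEN conjunct2]
  have u: "\<forall>l\<in>V. 0 < l \<bullet> u" using uU by (simp add: U_def)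
  have nzL: "\<forall>(v, c)\<in>set L. \<forall>i. c i \<bullet> u \<noteq> 0" using nzH by (fastforce simp: H_def)
  have nzV: "\<forall>l\<in>V. l \<bullet> u \<noteq> 0" using u by force
  define M where "M = map (\<lambda>(v, c). (v, c, {i. 0 < c i \<bullet> u})) L"
  show thesis
  proof (rule that[of M])
    show "\<forall>(v, c, S)\<in>set M. dual_bases v c \<and> (\<forall>i. orthant_lattice_vector (v i))"
      using L(1) by (auto simp: M_def)
    fix x
    have "of_bool (\<forall>l\<in>V. if 0 < l \<bullet> u then 0 \<le> l \<bullet> x else 0 < l \<bullet> x)
        = (\<Sum>(v, c)\<leftarrow>L. of_bool (x \<in> half_open_cone c {i. 0 < c i \<bullet> u}) :: nat)"
      by (intro half_open_identity V nzV nzL eventually_mono[OF ray[of x]]) (simp only: P_def)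
    then show "of_bool ((\<forall>j. 0 \<le> x $ j) \<and> (\<forall>l\<in>W. 0 \<le> l \<bullet> x))
        = (\<Sum>(v, c, S)\<leftarrow>M. of_bool (x \<in> half_open_cone c S) :: nat)"
      using u by (simp add: V_closed M_def comp_def case_prod_unfold)
    have "of_bool (\<forall>l\<in>V. if 0 < l \<bullet> - u then 0 \<le> l \<bullet> x else 0 < l \<bullet> x)
        = (\<Sum>(v, c)\<leftarrow>L. of_bool (x \<in> half_open_cone c {i. 0 < c i \<bullet> - u}) :: nat)"
    proof (rule half_open_identity)
      show "\<forall>l\<in>V. l \<bullet> - u \<noteq> 0" "\<forall>(v, c)\<in>set L. \<forall>i. c i \<bullet> - u \<noteq> 0"
        using nzV nzL by auto
      show "\<forall>\<^sub>F e in at_right 0. of_bool (\<forall>l\<in>V. 0 \<le> l \<bullet> (x + e *\<^sub>R - u))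
          = (\<Sum>(v, c)\<leftarrow>L. of_bool (\<forall>i. 0 \<le> c i \<bullet> (x + e *\<^sub>R - u)) :: nat)"
        by (rule eventually_mono[OF ray[of x]]) (simp only: P_def)
    qed (rule V)
    moreover have "(\<forall>l\<in>V. if 0 < l \<bullet> - u then 0 \<le> l \<bullet> x else 0 < l \<bullet> x) \<longleftrightarrow> (\<forall>l\<in>V. 0 < l \<bullet> x)"
      using u by force
    \<comment> \<open>No \<open>c i \<bullet> u\<close> vanishes, so reversing the direction
      complements the set of kept facets.\<close>
    moreover have "{i. 0 < c i \<bullet> - u} = - {i. 0 < c i \<bullet> u}" if "(v, c) \<in> set L" for v c
      using nzL that by (auto simp: less_le)
    then have "(\<Sum>(v, c)\<leftarrow>L. of_bool (x \<in> half_open_cone c {i. 0 < c i \<bullet> - u}) :: nat)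
        = (\<Sum>(v, c)\<leftarrow>L. of_bool (x \<in> half_open_cone c (- {i. 0 < c i \<bullet> u})))"
      by (intro arg_cong[where f = sum_list] map_cong) auto
    ultimately show "of_bool ((\<forall>j. 0 < x $ j) \<and> (\<forall>l\<in>W. 0 < l \<bullet> x))
        = (\<Sum>(v, c, S)\<leftarrow>M. of_bool (x \<in> half_open_cone c (- S)) :: nat)"
      by (simp add: V_open M_def comp_def case_prod_unfold)
  qed
qed

subsection \<open>Generating functions of half-open simplicial cones\<close>

definition lattice_simplex :: "nat \<Rightarrow> (real ^ 'n) set" where
  "lattice_simplex k = {x. orthant_lattice_vector x \<and> (\<Sum>j\<in>UNIV. x $ j) = real k}"

text \<open>Since \<open>card\<close> of an infinite set is 0, finiteness is what makes the
  coefficients of \<open>lattice_gf\<close> genuine counts, additive over disjoint unions.\<close>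

lemma finite_lattice_simplex: "finite (lattice_simplex k :: (real ^ 'n) set)"
proof (rule finite_subset)
  show "lattice_simplex k \<subseteq> (\<lambda>f. \<chi> j. real (f j)) ` (UNIV \<rightarrow>\<^sub>E {..k} :: ('n \<Rightarrow> nat) set)"
  proof
    fix x :: "real ^ 'n" assume x: "x \<in> lattice_simplex k"
    have "\<exists>n. x $ j = real n \<and> n \<le> k" for j
    proof -
      have j: "x $ j \<in> \<int>" "0 \<le> x $ j" and nn: "\<forall>i. 0 \<le> x $ i"
        using x by (auto simp: lattice_simplex_def orthant_lattice_vector_def lattice_points_def)
      then obtain n where n: "x $ j = real n" by (metis Ints_cases of_int_0_le_iff of_int_of_nat_eq nonneg_int_cases)
      have "x $ j \<le> (\<Sum>i\<in>UNIV. x $ i)" using nn by (intro member_le_sum) auto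
      then show ?thesis using x n by (auto simp: lattice_simplex_def)
    qed
    then obtain f where f: "\<And>j. x $ j = real (f j)" "\<And>j. f j \<le> k" by metis
    then have "x = (\<chi> j. real (f j))" by (simp add: vec_eq_iff)
    then show "x \<in> (\<lambda>f. \<chi> j. real (f j)) ` (UNIV \<rightarrow>\<^sub>E {..k})" using f(2) by auto
  qed
  show "finite ((\<lambda>f. \<chi> j. real (f j)) ` (UNIV \<rightarrow>\<^sub>E {..k} :: ('n \<Rightarrow> nat) set))"
    by (intro finite_imageI finite_PiE) auto
qed

definition lattice_gf :: "(real ^ 'n) set \<Rightarrow> rat fps" where
  "lattice_gf A = Abs_fps (\<lambda>k. of_nat (card (A \<inter> lattice_simplex k)))"

lemma lattice_simplex_sum: "x \<in> lattice_simplex k \<Longrightarrow> (\<Sum>j\<in>UNIV. x $ j) = real k"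
  by (simp add: lattice_simplex_def)

section \<open>Fundamental boxes of half-open simplicial cones\<close>

lemma dual_bases_orthant:
  assumes "dual_bases v c" "\<forall>i. orthant_lattice_vector (v i)" "\<forall>i. 0 \<le> c i \<bullet> x"
  shows "0 \<le> x $ j"
proof -
  have "x $ j = (\<Sum>i\<in>UNIV. (c i \<bullet> x) *\<^sub>R v i) $ j"
    using assms(1) unfolding dual_bases_def by metis
  also have "\<dots> \<ge> 0"
    using assms(2,3) by (auto simp: orthant_lattice_vector_def intro!: sum_nonneg)
  finally show ?thesis .
qed

text \<open>The set \<open>T\<close> of bounded coordinates interpolates between the cone
  (\<open>T = {}\<close>) and its fundamental parallelepiped (\<open>T = UNIV\<close>). A bounded
  coordinate runs through [0,1) or (0,1], so that integer translates tile without overlap.\<close>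

definition half_open_box :: "('n \<Rightarrow> real ^ 'n) \<Rightarrow> 'n set \<Rightarrow> 'n set \<Rightarrow> (real ^ 'n) set" where
  "half_open_box c S T = half_open_cone c S
     \<inter> {x. \<forall>i\<in>T. if i \<in> S then c i \<bullet> x < 1 else c i \<bullet> x \<le> 1}"

lemma half_open_box_empty [simp]: "half_open_box c S {} = half_open_cone c S"
  by (simp add: half_open_box_def)

lemma half_open_cone_nonneg: "x \<in> half_open_cone c S \<Longrightarrow> 0 \<le> c i \<bullet> x"
  by (auto simp: half_open_cone_def less_imp_le split: if_splits)

text \<open>Bounding the coordinate at \<open>v j\<close> to one period removes exactly the
  translate by \<open>v j\<close>, whose points have degree larger by \<open>g\<close>.\<close>

lemma half_open_box_translate:
  assumes db: "dual_bases v c" and ol: "\<forall>i. orthant_lattice_vector (v i)"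
    and g: "(\<Sum>i\<in>UNIV. v j $ i) = real g" and j: "j \<notin> T"
  shows "(half_open_box c S T - half_open_box c S (insert j T)) \<inter> lattice_simplex k
    = (if k < g then {} else (\<lambda>x. x + v j) ` (half_open_box c S T \<inter> lattice_simplex (k - g)))"
proof -
  have cv: "c i \<bullet> v j = of_bool (i = j)" for i using db unfolding dual_bases_def by blast
  have nn: "0 \<le> x $ i" if "x \<in> half_open_box c S T" for x i
    using dual_bases_orthant[OF db ol, of x i] half_open_cone_nonneg that
    unfolding half_open_box_def by blast
  have sh: "x + v j \<in> half_open_box c S T - half_open_box c S (insert j T)
      \<longleftrightarrow> x \<in> half_open_box c S T" for x
  proof -
    have ci: "c i \<bullet> (x + v j) = c i \<bullet> x" if "i \<noteq> j" for i
      using that by (simp add: inner_add_right cv)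
    have cj: "c j \<bullet> (x + v j) = c j \<bullet> x + 1" by (simp add: inner_add_right cv)
    \<comment> \<open>These are the conditions untouched by the translation: the lower bounds at
      indices other than \<open>j\<close>, and the upper bounds on \<open>T\<close>, which does not
      contain \<open>j\<close>.\<close>
    define R where "R y \<longleftrightarrow> (\<forall>i. i \<noteq> j \<longrightarrow> (if i \<in> S then 0 \<le> c i \<bullet> y else 0 < c i \<bullet> y))
        \<and> (\<forall>i\<in>T. if i \<in> S then c i \<bullet> y < 1 else c i \<bullet> y \<le> 1)" for y
    have T: "y \<in> half_open_box c S T \<longleftrightarrow> R y \<and> (if j \<in> S then 0 \<le> c j \<bullet> y else 0 < c j \<bullet> y)" for y
    proof -
      have split: "(\<forall>i. Q i) \<longleftrightarrow> (\<forall>i. i \<noteq> j \<longrightarrow> Q i) \<and> Q j" for Q by metis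
      show ?thesis
        unfolding half_open_box_def half_open_cone_def R_def Int_iff mem_Collect_eq
          split[of "\<lambda>i. if i \<in> S then 0 \<le> c i \<bullet> y else 0 < c i \<bullet> y"]
        by blast
    qed
    have insert: "y \<in> half_open_box c S (insert j T)
        \<longleftrightarrow> y \<in> half_open_box c S T \<and> (if j \<in> S then c j \<bullet> y < 1 else c j \<bullet> y \<le> 1)" for y
      unfolding half_open_box_def by (simp only: Int_iff mem_Collect_eq ball_simps) blast
    have "R (x + v j) \<longleftrightarrow> R x"
      unfolding R_def using ci j by (intro arg_cong2[where f = "(\<and>)"] all_cong ball_cong refl) (simp, metis)
    then show ?thesis
      unfolding Diff_iff insert T cj by (cases "j \<in> S") auto
  qed
  have lat: "x + v j \<in> lattice_simplex k \<longleftrightarrow> g \<le> k \<and> x \<in> lattice_simplex (k - g)"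
    if "x \<in> half_open_box c S T" for x
  proof -
    have vl: "v j \<in> lattice_points" "\<forall>i. 0 \<le> v j $ i"
      using ol by (auto simp: orthant_lattice_vector_def)
    have "x + v j \<in> lattice_points \<longleftrightarrow> x \<in> lattice_points"
    proof
      assume a: "x + v j \<in> lattice_points"
      have "x $ i = (x + v j) $ i - v j $ i" for i by simp
      then show "x \<in> lattice_points"
        using a vl(1) unfolding lattice_points_def mem_Collect_eq by (metis Ints_diff)
    qed (use vl in \<open>auto simp: lattice_points_def\<close>)
    moreover have "(\<Sum>i\<in>UNIV. (x + v j) $ i) = (\<Sum>i\<in>UNIV. x $ i) + real g"
      by (simp add: sum.distrib g)
    \<comment> \<open>The degree of \<open>x\<close> is nonnegative, which forces
      \<open>g \<le> k\<close>; the subtraction \<open>k - g\<close> is then not truncated.\<close>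
    moreover have "0 \<le> (\<Sum>i\<in>UNIV. x $ i)" using nn[OF that] by (intro sum_nonneg) auto
    ultimately show ?thesis
      using nn[OF that] vl by (auto simp: lattice_simplex_def orthant_lattice_vector_def of_nat_diff)
  qed
  show ?thesis (is "?L = ?R")
  proof (intro equalityI subsetI)
    fix y assume y: "y \<in> ?L"
    define x where "x = y - v j"
    have yx: "y = x + v j" by (simp add: x_def)
    then have "x \<in> half_open_box c S T" using y sh by blast
    then show "y \<in> ?R" using y lat yx by auto
  next
    fix y assume "y \<in> ?R"
    then obtain x where "\<not> k < g" "y = x + v j" "x \<in> half_open_box c S T" "x \<in> lattice_simplex (k - g)"
      by (auto split: if_splits)
    then show "y \<in> ?L" using sh[of x] lat[of x] by simp
  qed
qed

text \<open>The removed translate contributes t^g times the series of the larger set.\<close>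

lemma lattice_gf_half_open_box_insert:
  assumes "dual_bases v c" "\<forall>i. orthant_lattice_vector (v i)"
    and "(\<Sum>i\<in>UNIV. v j $ i) = real g" "j \<notin> T"
  shows "lattice_gf (half_open_box c S (insert j T)) = (1 - fps_X ^ g) * lattice_gf (half_open_box c S T)"
proof (rule fps_ext)
  fix k
  let ?A = "half_open_box c S T \<inter> lattice_simplex k"
  let ?B = "half_open_box c S (insert j T) \<inter> lattice_simplex k"
  have BA: "?B \<subseteq> ?A" by (auto simp: half_open_box_def)
  have "?A - ?B = (half_open_box c S T - half_open_box c S (insert j T)) \<inter> lattice_simplex k"
    by blast
  then have "card (?A - ?B)
      = (if k < g then 0 else card (half_open_box c S T \<inter> lattice_simplex (k - g)))"
    unfolding half_open_box_translate[OF assms] by (simp add: card_image)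
  moreover have "card ?A = card ?B + card (?A - ?B)"
    using BA finite_lattice_simplex by (metis card_Diff_subset card_mono finite_Int finite_subset le_add_diff_inverse)
  ultimately have "(of_nat (card ?B) :: rat)
      = of_nat (card ?A) - (if k < g then 0 else of_nat (card (half_open_box c S T \<inter> lattice_simplex (k - g))))"
    by simp
  then show "fps_nth (lattice_gf (half_open_box c S (insert j T))) k
      = fps_nth ((1 - fps_X ^ g) * lattice_gf (half_open_box c S T)) k"
    by (simp add: lattice_gf_def left_diff_distrib fps_X_power_mult_nth)
qed

lemma lattice_gf_half_open_box:
  assumes "dual_bases v c" "\<forall>i. orthant_lattice_vector (v i)"
    and "\<And>j. (\<Sum>i\<in>UNIV. v j $ i) = real (g j)"
  shows "lattice_gf (half_open_box c S T) = (\<Prod>j\<in>T. 1 - fps_X ^ g j) * lattice_gf (half_open_cone c S)"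
  using finite[of T]
proof (induction rule: finite_induct)
  case (insert j T)
  then show ?case
    using lattice_gf_half_open_box_insert[OF assms(1,2) assms(3)[of j], of T S]
    by (simp add: mult.assoc)
qed simp_all

text \<open>With s the sum of the generators, x -> s - x replaces each coordinate a by 1 - a. This
  exchanges [0,1) with (0,1], hence \<open>S\<close> with \<open>- S\<close>, and sends degree k to
  the degree of s minus k. Both boxes lie in the orthant, so no point has degree above that of
  s.\<close>

lemma card_half_open_box_reflect:
  assumes db: "dual_bases v c" and ol: "\<forall>i. orthant_lattice_vector (v i)"
    and g: "\<And>j. (\<Sum>i\<in>UNIV. v j $ i) = real (g j)"
  shows "card (half_open_box c S UNIV \<inter> lattice_simplex k)
    = (if k \<le> sum g UNIV then card (half_open_box c (- S) UNIV \<inter> lattice_simplex (sum g UNIV - k)) else 0)"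
proof -
  define s where "s = (\<Sum>j\<in>UNIV. v j)"
  have cs: "c i \<bullet> s = 1" for i
    using db by (simp add: s_def dual_bases_def inner_sum_right of_bool_def)
  have box: "s - x \<in> half_open_box c (- S) UNIV" if "x \<in> half_open_box c S UNIV" for x S
    using that by (fastforce simp: half_open_box_def half_open_cone_def inner_diff_right cs split: if_splits)
  have nn: "0 \<le> x $ i" if "x \<in> half_open_box c S UNIV" for x i S
    using dual_bases_orthant[OF db ol, of x i] half_open_cone_nonneg that
    unfolding half_open_box_def by blast
  have sum_s: "(\<Sum>i\<in>UNIV. s $ i) = real (sum g UNIV)"
    unfolding s_def sum_component by (subst sum.swap) (simp add: g)
  have s: "s \<in> lattice_points"
    using ol by (auto simp: s_def lattice_points_def orthant_lattice_vector_def intro!: Ints_sum)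
  have lat: "k \<le> sum g UNIV \<and> s - x \<in> lattice_simplex (sum g UNIV - k)"
    if "x \<in> half_open_box c S UNIV" "x \<in> lattice_simplex k" for x S k
  proof -
    have "\<forall>i. 0 \<le> (s - x) $ i" using nn[OF box[OF that(1)]] by blast
    moreover from this have "0 \<le> (\<Sum>i\<in>UNIV. (s - x) $ i)" by (intro sum_nonneg) auto
    moreover have "(\<Sum>i\<in>UNIV. (s - x) $ i) = real (sum g UNIV) - real k"
      using lattice_simplex_sum[OF that(2)] by (simp add: sum_subtractf sum_s del: of_nat_sum)
    moreover have "s - x \<in> lattice_points"
      using s that(2) by (auto simp: lattice_simplex_def orthant_lattice_vector_def lattice_points_def)
    ultimately show ?thesis
      by (auto simp: lattice_simplex_def orthant_lattice_vector_def of_nat_diff simp del: of_nat_sum)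
  qed
  show ?thesis
  proof (cases "k \<le> sum g UNIV")
    case True
    have "bij_betw (\<lambda>x. s - x) (half_open_box c S UNIV \<inter> lattice_simplex k)
        (half_open_box c (- S) UNIV \<inter> lattice_simplex (sum g UNIV - k))"
      using box[of _ S] box[of _ "- S"] lat[of _ S k] lat[of _ "- S" "sum g UNIV - k"] True
      by (intro bij_betw_byWitness[where f' = "\<lambda>x. s - x"]) auto
    then show ?thesis using True by (simp add: bij_betw_same_card)
  next
    case False
    then have "half_open_box c S UNIV \<inter> lattice_simplex k = {}" using lat[of _ S k] by auto
    then show ?thesis using False by simp
  qed
qed

subsection \<open>Rational functions and reciprocity\<close>

definition fls_eval :: "rat fls \<Rightarrow> rat poly \<Rightarrow> rat fls" where
  "fls_eval z p = poly (map_poly fls_const p) z"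

lemma ratfun_eq_fls_eval: "ratfun p q z = fls_eval z p / fls_eval z q"
  by (simp add: ratfun_def fls_eval_def)

lemma fls_eval_0 [simp]: "fls_eval z 0 = 0"
  by (simp add: fls_eval_def)

lemma fls_eval_1 [simp]: "fls_eval z 1 = 1"
  by (simp add: fls_eval_def)

lemma fls_eval_pCons: "fls_eval z (pCons a p) = fls_const a + z * fls_eval z p"
  by (simp add: fls_eval_def map_poly_pCons)

lemma fls_eval_monom: "fls_eval z (monom a n) = fls_const a * z ^ n"
  by (simp add: fls_eval_def map_poly_monom poly_monom)

lemma fls_eval_add: "fls_eval z (p + q) = fls_eval z p + fls_eval z q"
  by (induction p q rule: poly_induct2)
     (simp_all add: fls_eval_pCons fls_plus_const[symmetric] algebra_simps)

lemma fls_eval_smult: "fls_eval z (smult a p) = fls_const a * fls_eval z p"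
  by (induction p)
     (simp_all add: fls_eval_pCons fls_const_mult_const[symmetric] algebra_simps del: fls_const_mult_const)

lemma fls_eval_mult: "fls_eval z (p * q) = fls_eval z p * fls_eval z q"
  by (induction p) (simp_all add: fls_eval_pCons fls_eval_add fls_eval_smult algebra_simps)

lemma fls_eval_diff: "fls_eval z (p - q) = fls_eval z p - fls_eval z q"
  using fls_eval_add[of z "p - q" q] by simp

lemma fls_eval_sum: "fls_eval z (\<Sum>i\<in>A. f i) = (\<Sum>i\<in>A. fls_eval z (f i))"
  by (induction A rule: infinite_finite_induct) (simp_all add: fls_eval_add)

lemma fls_eval_prod: "fls_eval z (\<Prod>i\<in>A. f i) = (\<Prod>i\<in>A. fls_eval z (f i))"
  by (induction A rule: infinite_finite_induct) (simp_all add: fls_eval_mult)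

lemma fls_eval_fls_X: "fls_eval fls_X p = fps_to_fls (fps_of_poly p)"
  by (induction p) (simp_all add: fls_eval_pCons fps_of_poly_pCons fls_times_fps_to_fls)

lemma fls_eval_fls_X_eq_iff: "fls_eval fls_X p = fls_eval fls_X q \<longleftrightarrow> p = q"
  by (simp add: fls_eval_fls_X fps_of_poly_eq_iff)

text \<open>Distinct powers of 1/t do not interact, so all coefficients of the polynomial can be
  recovered. Hence a nonzero denominator stays nonzero at 1/t.\<close>

lemma fls_eval_inverse_fls_X_nth:
  "fls_nth (fls_eval (inverse fls_X) p) n = (if n \<le> 0 then coeff p (nat (- n)) else 0)"
proof (induction p arbitrary: n)
  case (pCons a p)
  consider "n = 0" | "0 < n" | k where "n = - int (Suc k)"
    by (metis int_cases neg_0_equal_iff_equal nat_int_comparison(2) of_nat_0_less_iff zero_less_Suc not_gr_zero of_nat_0)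
  then show ?case
    using pCons.IH[of "n + 1"]
    by cases (simp_all add: fls_eval_pCons fls_inverse_X fls_X_inv_times_conv_shift nat_add_distrib)
qed simp

lemma fls_eval_nonzero:
  assumes "q \<noteq> 0"
  shows "fls_eval fls_X q \<noteq> 0" "fls_eval (inverse fls_X) q \<noteq> 0"
proof -
  show "fls_eval fls_X q \<noteq> 0" using assms fls_eval_fls_X_eq_iff[of q 0] by simp
  obtain k where "coeff q k \<noteq> 0" using assms by (metis leading_coeff_0_iff)
  then have "fls_nth (fls_eval (inverse fls_X) q) (- int k) \<noteq> 0"
    by (simp add: fls_eval_inverse_fls_X_nth)
  then show "fls_eval (inverse fls_X) q \<noteq> 0" by (metis fls_zero_nth)
qed

text \<open>Equality at t becomes a polynomial identity after cross-multiplication, and that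
  identity can be evaluated at 1/t. So the value at 1/t depends on the rational function only and
  not on the fraction that represents it.\<close>

lemma ratfun_inverse_fls_X_cong:
  assumes "q \<noteq> 0" "q' \<noteq> 0" "ratfun p q fls_X = ratfun p' q' fls_X"
  shows "ratfun p q (inverse fls_X) = ratfun p' q' (inverse fls_X)"
proof -
  have "fls_eval fls_X (p * q') = fls_eval fls_X (p' * q)"
    using assms(3) fls_eval_nonzero(1)[OF assms(1)] fls_eval_nonzero(1)[OF assms(2)]
    by (simp add: ratfun_eq_fls_eval fls_eval_mult frac_eq_eq)
  then have "p * q' = p' * q" by (simp only: fls_eval_fls_X_eq_iff)
  then have "fls_eval (inverse fls_X) (p * q') = fls_eval (inverse fls_X) (p' * q)" by simp
  then show ?thesis
    using fls_eval_nonzero(2)[OF assms(1)] fls_eval_nonzero(2)[OF assms(2)]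
    by (simp add: ratfun_eq_fls_eval fls_eval_mult frac_eq_eq)
qed

lemma ratfun_add:
  assumes "q \<noteq> 0" "q' \<noteq> 0" "z \<in> {fls_X, inverse fls_X}"
  shows "ratfun (p * q' + p' * q) (q * q') z = ratfun p q z + ratfun p' q' z"
proof -
  have "fls_eval z q \<noteq> 0" "fls_eval z q' \<noteq> 0" using assms fls_eval_nonzero by blast+
  then show ?thesis
    by (simp add: ratfun_eq_fls_eval fls_eval_mult fls_eval_add add_frac_eq)
qed

text \<open>\<open>F\<close> and \<open>G\<close> are the expansions at 0 of R(t) and (-1)^d R(1/t)
  for one rational function R. By \<open>ratfun_inverse_fls_X_cong\<close> the choice of the
  fraction is immaterial.\<close>

definition reciprocal_series :: "nat \<Rightarrow> rat fps \<Rightarrow> rat fps \<Rightarrow> bool" where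
  "reciprocal_series d F G \<longleftrightarrow> (\<exists>p q. q \<noteq> 0 \<and> fps_to_fls F = ratfun p q fls_X
     \<and> fps_to_fls G = (- 1) ^ d * ratfun p q (inverse fls_X))"

lemma reciprocal_series_add:
  assumes "reciprocal_series d F G" "reciprocal_series d F' G'"
  shows "reciprocal_series d (F + F') (G + G')"
proof -
  obtain p q where 1: "q \<noteq> 0" "fps_to_fls F = ratfun p q fls_X"
      "fps_to_fls G = (- 1) ^ d * ratfun p q (inverse fls_X)"
    using assms(1) unfolding reciprocal_series_def by blast
  obtain p' q' where 2: "q' \<noteq> 0" "fps_to_fls F' = ratfun p' q' fls_X"
      "fps_to_fls G' = (- 1) ^ d * ratfun p' q' (inverse fls_X)"
    using assms(2) unfolding reciprocal_series_def by blast
  show ?thesis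
    unfolding reciprocal_series_def
    by (rule exI[of _ "p * q' + p' * q"], rule exI[of _ "q * q'"])
       (use 1 2 in \<open>simp add: ratfun_add distrib_left\<close>)
qed

lemma reciprocal_series_sum_list:
  assumes "\<And>x. x \<in> set L \<Longrightarrow> reciprocal_series d (F x) (G x)"
  shows "reciprocal_series d (\<Sum>x\<leftarrow>L. F x) (\<Sum>x\<leftarrow>L. G x)"
  using assms
proof (induction L)
  case Nil
  show ?case
    unfolding reciprocal_series_def
    by (rule exI[of _ 0], rule exI[of _ 1]) (simp add: ratfun_eq_fls_eval)
qed (simp add: reciprocal_series_add)

section \<open>Denominators that are products of factors 1 - t^g\<close>

definition geometric_denominator :: "('a \<Rightarrow> nat) \<Rightarrow> 'a set \<Rightarrow> rat poly" where
  "geometric_denominator g A = (\<Prod>i\<in>A. 1 - monom 1 (g i))"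

lemma geometric_denominator_nonzero:
  assumes "finite A" "\<And>i. i \<in> A \<Longrightarrow> 0 < g i"
  shows "geometric_denominator g A \<noteq> 0"
proof -
  have "coeff (1 - monom 1 (g i) :: rat poly) 0 = 1" if "i \<in> A" for i
    using assms(2)[OF that] by simp
  then have "1 - monom 1 (g i) \<noteq> (0 :: rat poly)" if "i \<in> A" for i
    using that by (metis coeff_0 zero_neq_one)
  then show ?thesis using assms(1) by (simp add: geometric_denominator_def)
qed

lemma fls_eval_geometric_denominator:
  "fls_eval z (geometric_denominator g A) = (\<Prod>i\<in>A. 1 - z ^ g i)"
  by (simp add: geometric_denominator_def fls_eval_prod fls_eval_diff fls_eval_monom)

lemma geometric_denominator_reciprocity:
  "fls_X ^ (\<Sum>i\<in>A. g i) * fls_eval (inverse fls_X) (geometric_denominator g A)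
     = (- 1) ^ card A * fls_eval fls_X (geometric_denominator g A)"
proof -
  have "fls_X ^ g i * (1 - inverse fls_X ^ g i) = - 1 * (1 - fls_X ^ g i :: rat fls)" for i
    by (simp add: right_diff_distrib flip: power_mult_distrib)
  then have "(\<Prod>i\<in>A. fls_X ^ g i * (1 - inverse fls_X ^ g i)) = (\<Prod>i\<in>A. - 1 * (1 - fls_X ^ g i :: rat fls))"
    by (intro prod.cong refl)
  then show ?thesis
    by (simp only: fls_eval_geometric_denominator power_sum prod.distrib prod_constant)
qed

text \<open>Each factor 1 - t^(-g) equals -t^(-g) (1 - t^g). The signs cancel against the power of
  -1, and the powers of t move to the numerator.\<close>

lemma ratfun_geometric_denominator:
  assumes "finite A" "\<And>i. i \<in> A \<Longrightarrow> 0 < g i"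
  shows "(- 1) ^ card A * ratfun p (geometric_denominator g A) (inverse fls_X)
    = fls_X ^ (\<Sum>i\<in>A. g i) * fls_eval (inverse fls_X) p / (\<Prod>i\<in>A. 1 - fls_X ^ g i)"
proof -
  let ?q = "geometric_denominator g A" and ?G = "fls_X ^ (\<Sum>i\<in>A. g i) :: rat fls"
  have q: "fls_eval fls_X ?q \<noteq> 0" "fls_eval (inverse fls_X) ?q \<noteq> 0"
    using fls_eval_nonzero geometric_denominator_nonzero[of A g] assms by blast+
  have "fls_eval fls_X ?q = (- 1) ^ card A * (?G * fls_eval (inverse fls_X) ?q)"
    unfolding geometric_denominator_reciprocity by (simp flip: mult.assoc power_mult_distrib)
  moreover have "?G \<noteq> 0" by simp
  \<comment> \<open>Here \<open>a\<close> stands for the sign \<open>(- 1) ^ card A\<close>, whose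
    square is 1, and \<open>y\<close> for the denominator at 1/t.\<close>
  moreover have "a * (x / y) = G * x / (a * (G * y))" if "a * a = 1" "G \<noteq> 0" "y \<noteq> 0"
    for a x y G :: "rat fls"
  proof -
    have "a \<noteq> 0" using that(1) by auto
    then have "G * x / (a * (G * y)) = x / (a * y)" using that(2) by simp
    also have "\<dots> = (a * a) * (x / (a * y))" using that(1) by simp
    also have "\<dots> = a * (x / y)" using \<open>a \<noteq> 0\<close> by (simp add: field_simps)
    finally show ?thesis by simp
  qed
  ultimately show ?thesis
    using q(2) by (simp add: ratfun_eq_fls_eval fls_eval_geometric_denominator flip: power_mult_distrib)
qed

text \<open>Both cones have the denominator \<open>q\<close>. Their numerators count the boxes for
  \<open>S\<close> and \<open>- S\<close> by degree, and by the reflection of the box these are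
  reversals of each other in degree \<open>G\<close>.\<close>

lemma reciprocal_series_half_open_cone:
  fixes v c :: "'n \<Rightarrow> real ^ 'n"
  assumes db: "dual_bases v c" and ol: "\<forall>i. orthant_lattice_vector (v i)"
  shows "reciprocal_series CARD('n) (lattice_gf (half_open_cone c S)) (lattice_gf (half_open_cone c (- S)))"
proof -
  \<comment> \<open>A generator is a nonzero lattice vector of the orthant, so its degree is a
    positive integer; a degree of 0 would make the denominator vanish.\<close>
  have "\<exists>n. (\<Sum>i\<in>UNIV. v j $ i) = real n \<and> 0 < n" for j
  proof -
    have "(\<Sum>i\<in>UNIV. v j $ i) \<in> \<int>" "0 \<le> (\<Sum>i\<in>UNIV. v j $ i)"
      using ol by (auto simp: orthant_lattice_vector_def lattice_points_def intro!: Ints_sum sum_nonneg)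
    then obtain n where n: "(\<Sum>i\<in>UNIV. v j $ i) = real n"
      by (metis Ints_cases of_int_0_le_iff of_int_of_nat_eq nonneg_int_cases)
    have "c j \<bullet> v j = 1" using db unfolding dual_bases_def by simp
    then have "v j \<noteq> 0" by auto
    then have "(\<Sum>i\<in>UNIV. v j $ i) \<noteq> 0"
      using ol nonneg_sum_zero_iff[of "v j"] by (auto simp: orthant_lattice_vector_def)
    then show ?thesis using n by auto
  qed
  then obtain g where g: "\<And>j. (\<Sum>i\<in>UNIV. v j $ i) = real (g j)" "\<And>j. 0 < g j" by metis
  define G where "G = sum g UNIV"
  define N where "N S k = card (half_open_box c S UNIV \<inter> lattice_simplex k)" for S k
  define p where "p S = (\<Sum>k\<le>G. monom (of_nat (N S k)) k :: rat poly)" for S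
  define q where "q = geometric_denominator g UNIV"
  \<comment> \<open>The case \<open>k > G\<close> shows that the sums in \<open>p\<close>, which
    stop at \<open>G\<close>, lose no box point.\<close>
  have N: "N S k = (if k \<le> G then N (- S) (G - k) else 0)" for S k
    unfolding N_def G_def by (rule card_half_open_box_reflect[OF db ol g(1)])
  have q: "q \<noteq> 0" unfolding q_def using g(2) by (intro geometric_denominator_nonzero) auto
  have qX: "fls_eval fls_X q = (\<Prod>i\<in>UNIV. 1 - fls_X ^ g i)"
    by (simp add: q_def fls_eval_geometric_denominator)
  have "fps_of_poly (p S) = lattice_gf (half_open_box c S UNIV)" for S
  proof (rule fps_ext)
    show "fps_nth (fps_of_poly (p S)) k = fps_nth (lattice_gf (half_open_box c S UNIV)) k" for k
      using N[of S k] by (simp add: p_def lattice_gf_def coeff_sum N_def[symmetric])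
  qed
  moreover have "fps_of_poly q = (\<Prod>j\<in>UNIV. 1 - fps_X ^ g j)"
    by (simp add: q_def geometric_denominator_def fps_of_poly_prod fps_of_poly_diff fps_of_poly_monom)
  ultimately have "fps_of_poly (p S) = fps_of_poly q * lattice_gf (half_open_cone c S)" for S
    using lattice_gf_half_open_box[OF db ol g(1), of S UNIV] by simp
  then have "fls_eval fls_X (p S) = fls_eval fls_X q * fps_to_fls (lattice_gf (half_open_cone c S))" for S
    by (simp add: fls_eval_fls_X fls_times_fps_to_fls)
  then have cone: "fps_to_fls (lattice_gf (half_open_cone c S)) = ratfun (p S) q fls_X" for S
    using fls_eval_nonzero(1)[OF q] by (simp add: ratfun_eq_fls_eval)
  have "fls_X ^ G * fls_eval (inverse fls_X) (p S) = fls_eval fls_X (p (- S))" for S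
  proof -
    have "fls_X ^ G * fls_eval (inverse fls_X) (p S)
        = (\<Sum>k\<le>G. fls_const (of_nat (N S k)) * (fls_X ^ G * inverse fls_X ^ k))"
      by (simp add: p_def fls_eval_sum fls_eval_monom sum_distrib_left mult.left_commute)
    also have "\<dots> = (\<Sum>k\<le>G. fls_const (of_nat (N (- S) k)) * fls_X ^ k)"
    proof (rule sum.reindex_bij_witness[of _ "\<lambda>k. G - k" "\<lambda>k. G - k"])
      fix k assume k: "k \<in> {..G}"
      have "(fls_X :: rat fls) ^ G = fls_X ^ (G - k) * fls_X ^ k"
        using k by (simp flip: power_add)
      then have "(fls_X :: rat fls) ^ G * inverse fls_X ^ k = fls_X ^ (G - k) * (fls_X * inverse fls_X) ^ k"
        by (simp only: power_mult_distrib mult.assoc)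
      then have "(fls_X :: rat fls) ^ G * inverse fls_X ^ k = fls_X ^ (G - k)" by simp
      moreover have "N S k = N (- S) (G - k)" using k N[of S k] by simp
      ultimately show "fls_const (of_nat (N (- S) (G - k))) * fls_X ^ (G - k)
          = (fls_const (of_nat (N S k)) * (fls_X ^ G * inverse fls_X ^ k) :: rat fls)"
        by (simp only:)
    qed auto
    also have "\<dots> = fls_eval fls_X (p (- S))" by (simp add: p_def fls_eval_sum fls_eval_monom)
    finally show ?thesis .
  qed
  then have "(- 1) ^ CARD('n) * ratfun (p S) q (inverse fls_X) = ratfun (p (- S)) q fls_X"
    using ratfun_geometric_denominator[of "UNIV :: 'n set" g "p S"] g(2)
    by (simp add: q_def[symmetric] G_def[symmetric] ratfun_eq_fls_eval qX)
  then show ?thesis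
    unfolding reciprocal_series_def using q cone by metis
qed

section \<open>Reciprocity assembled from the simplicial pieces\<close>

lemma lattice_gf_sum_list:
  fixes A :: "(real ^ 'n) set"
  assumes "\<And>x. of_bool (x \<in> A) = (\<Sum>y\<leftarrow>L. of_bool (x \<in> B y) :: nat)"
  shows "lattice_gf A = (\<Sum>y\<leftarrow>L. lattice_gf (B y))"
proof (rule fps_ext)
  fix k
  have card: "card (C \<inter> lattice_simplex k) = (\<Sum>x\<in>lattice_simplex k. of_bool (x \<in> C))" for C :: "(real ^ 'n) set"
    by (simp add: finite_lattice_simplex Int_commute)
  have swap: "(\<Sum>x\<in>lattice_simplex k. \<Sum>y\<leftarrow>L. of_bool (x \<in> B y))
      = (\<Sum>y\<leftarrow>L. \<Sum>x\<in>lattice_simplex k. of_bool (x \<in> B y) :: nat)"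
    by (induction L) (simp_all add: sum.distrib)
  have "card (A \<inter> lattice_simplex k) = (\<Sum>y\<leftarrow>L. card (B y \<inter> lattice_simplex k))"
    unfolding card assms swap ..
  moreover have "(of_nat (\<Sum>y\<leftarrow>L. card (B y \<inter> lattice_simplex k)) :: rat)
      = fps_nth (\<Sum>y\<leftarrow>L. lattice_gf (B y)) k"
    by (induction L) (simp_all add: lattice_gf_def)
  ultimately show "fps_nth (lattice_gf A) k = fps_nth (\<Sum>y\<leftarrow>L. lattice_gf (B y)) k"
    by (simp add: lattice_gf_def)
qed

text \<open>One list decomposes the closed cone with the facet sets S and the open one with their
  complements. Reciprocity therefore holds piece by piece, and it is preserved by sums.\<close>

theorem cone_reciprocity:
  fixes W :: "(real ^ 'n) set"
  assumes "finite W" "W \<subseteq> lattice_points" "\<forall>j. 0 < u $ j" "\<forall>l\<in>W. 0 < l \<bullet> u"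
  shows "reciprocal_series CARD('n) (lattice_gf {x. (\<forall>j. 0 \<le> x $ j) \<and> (\<forall>l\<in>W. 0 \<le> l \<bullet> x)})
    (lattice_gf {x. (\<forall>j. 0 < x $ j) \<and> (\<forall>l\<in>W. 0 < l \<bullet> x)})"
proof -
  obtain L where L: "\<forall>(v, c, S)\<in>set L. dual_bases v c \<and> (\<forall>i. orthant_lattice_vector (v i))"
    and closed: "\<And>x. of_bool ((\<forall>j. 0 \<le> x $ j) \<and> (\<forall>l\<in>W. 0 \<le> l \<bullet> x))
       = (\<Sum>(v, c, S)\<leftarrow>L. of_bool (x \<in> half_open_cone c S) :: nat)"
    and strict: "\<And>x. of_bool ((\<forall>j. 0 < x $ j) \<and> (\<forall>l\<in>W. 0 < l \<bullet> x))
       = (\<Sum>(v, c, S)\<leftarrow>L. of_bool (x \<in> half_open_cone c (- S)) :: nat)"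
    by (rule half_open_decomposition[OF assms]) (rule that)
  have 1: "lattice_gf {x. (\<forall>j. 0 \<le> x $ j) \<and> (\<forall>l\<in>W. 0 \<le> l \<bullet> x)}
      = (\<Sum>y\<leftarrow>L. lattice_gf (half_open_cone (fst (snd y)) (snd (snd y))))"
    using closed by (intro lattice_gf_sum_list) (simp add: case_prod_unfold)
  have 2: "lattice_gf {x. (\<forall>j. 0 < x $ j) \<and> (\<forall>l\<in>W. 0 < l \<bullet> x)}
      = (\<Sum>y\<leftarrow>L. lattice_gf (half_open_cone (fst (snd y)) (- snd (snd y))))"
    using strict by (intro lattice_gf_sum_list) (simp add: case_prod_unfold)
  show ?thesis
    unfolding 1 2
  proof (rule reciprocal_series_sum_list)
    fix y assume "y \<in> set L"
    moreover obtain v c S where "y = (v, c, S)" by (cases y)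
    ultimately show "reciprocal_series CARD('n) (lattice_gf (half_open_cone (fst (snd y)) (snd (snd y))))
        (lattice_gf (half_open_cone (fst (snd y)) (- snd (snd y))))"
      using L reciprocal_series_half_open_cone[of v c S] by auto
  qed
qed

subsection \<open>Cones defined by linear forms vanishing on the all-ones vector\<close>

lemma linear_eq_inner:
  fixes l :: "real ^ 'n \<Rightarrow> real"
  assumes "linear l"
  shows "l x = (\<chi> j. l (axis j 1)) \<bullet> x"
proof -
  have "l x = l (\<Sum>j\<in>UNIV. x $ j *\<^sub>R axis j 1)"
    using basis_expansion[of x] by (simp add: scalar_mult_eq_scaleR)
  also have "\<dots> = (\<Sum>j\<in>UNIV. x $ j * l (axis j 1))"
    using assms by (simp add: linear_sum linear_cmul)
  finally show ?thesis by (simp add: inner_vec_def mult.commute)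
qed

lemma common_denominator:
  fixes f :: "'a \<Rightarrow> real"
  assumes "finite A" "\<And>i. i \<in> A \<Longrightarrow> f i \<in> \<rat>"
  obtains k :: nat where "0 < k" "\<And>i. i \<in> A \<Longrightarrow> real k * f i \<in> \<int>"
proof -
  have "\<exists>k :: nat. 0 < k \<and> (\<forall>i\<in>A. real k * f i \<in> \<int>)"
    using assms
  proof (induction A rule: finite_induct)
    case (insert a A)
    then obtain k :: nat where k: "0 < k" "\<forall>i\<in>A. real k * f i \<in> \<int>" by auto
    obtain p q :: int where pq: "0 < q" "f a = of_int p / of_int q"
      using insert.prems[of a] by (metis Rats_cases' insertI1)
    have q: "real (nat q) = of_int q" using pq(1) by simp
    have "real (k * nat q) * f i \<in> \<int>" if "i \<in> insert a A" for i
    proof (cases "i = a")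
      case True
      then have "real (k * nat q) * f i = of_int (int k * p)" using pq q by simp
      then show ?thesis by (metis Ints_of_int)
    next
      case False
      then have "real (k * nat q) * f i = of_int q * (real k * f i)" by (simp add: q)
      moreover have "real k * f i \<in> \<int>" using k(2) that False by blast
      ultimately show ?thesis by (simp only: Ints_mult Ints_of_int)
    qed
    then show ?case using k(1) pq(1) by (intro exI[of _ "k * nat q"]) auto
  qed (auto intro: exI[of _ 1])
  then show thesis using that by blast
qed

lemma rational_form_lattice_vector:
  fixes l :: "real ^ 'n \<Rightarrow> real"
  assumes "linear l" "rational_form l"
  obtains w c where "w \<in> lattice_points" "0 < c" "\<And>x. w \<bullet> x = c * l x"
proof -
  obtain b where b: "b \<noteq> 0" "\<And>j. b * l (axis j 1) \<in> \<rat>"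
    using assms(2) unfolding rational_form_def by blast
  \<comment> \<open>The absolute value keeps the multiplier positive, so the half-space is not
    reversed.\<close>
  have "\<bar>b\<bar> * l (axis j 1) \<in> \<rat>" for j
    using b(2)[of j] by (cases "0 \<le> b") (auto simp: abs_if dest: Rats_minus_iff[THEN iffD2])
  then obtain k :: nat where k: "0 < k" "\<And>j. real k * (\<bar>b\<bar> * l (axis j 1)) \<in> \<int>"
    using common_denominator[of UNIV "\<lambda>j. \<bar>b\<bar> * l (axis j 1)"] by auto
  define w :: "real ^ 'n" where "w = (\<chi> j. real k * \<bar>b\<bar> * l (axis j 1))"
  show thesis
  proof (rule that[of w "real k * \<bar>b\<bar>"])
    show "w \<in> lattice_points" using k(2) by (simp add: w_def lattice_points_def mult.assoc)
    show "0 < real k * \<bar>b\<bar>" using k(1) b(1) by simp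
    have "w = (real k * \<bar>b\<bar>) *\<^sub>R (\<chi> j. l (axis j 1))" by (simp add: w_def vec_eq_iff)
    then show "w \<bullet> x = real k * \<bar>b\<bar> * l x" for x using linear_eq_inner[OF assms(1), of x] by simp
  qed
qed

text \<open>This is the interior of the closed cone once it is nonempty. For a form that is
  identically 0 it is empty although the closed cone may have interior points.\<close>

definition strict_cone :: "nat \<Rightarrow> (nat \<Rightarrow> real ^ 'n \<Rightarrow> real) \<Rightarrow> (real ^ 'n) set" where
  "strict_cone m lam = {x. (\<forall>j. 0 < x $ j) \<and> (\<forall>i\<in>{1..m}. 0 < lam i x)}"

text \<open>From an interior point \<open>x\<close> one can step back by a small multiple of
  \<open>u\<close> and stay in the closed cone. Hence each form at \<open>x\<close> is at least a
  positive multiple of its value at \<open>u\<close>.\<close>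

lemma interior_closed_cone:
  assumes lin: "\<And>i. i \<in> {1..m} \<Longrightarrow> linear (lam i)"
    and u: "u \<in> strict_cone m lam"
  shows "interior (closed_cone m lam) = strict_cone m lam"
proof
  have "strict_cone m lam = (\<Inter>j. {x. 0 < x $ j}) \<inter> (\<Inter>i\<in>{1..m}. {x. 0 < lam i x})"
    by (auto simp: strict_cone_def)
  also have "open \<dots>"
    using lin
    by (intro open_Int open_INT finite ballI open_Collect_less continuous_intros)
       (auto intro: linear_continuous_on simp: linear_conv_bounded_linear)
  finally show "strict_cone m lam \<subseteq> interior (closed_cone m lam)"
    by (intro interior_maximal) (auto simp: strict_cone_def closed_cone_def less_imp_le)
  show "interior (closed_cone m lam) \<subseteq> strict_cone m lam"
  proof
    fix x assume "x \<in> interior (closed_cone m lam)"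
    then obtain r where r: "0 < r" "ball x r \<subseteq> closed_cone m lam" by (auto simp: mem_interior)
    \<comment> \<open>The step \<open>e *\<^sub>R u\<close> must be shorter than \<open>r\<close>;
      adding 1 keeps the denominator positive for every \<open>u\<close>.\<close>
    define e where "e = r / (2 * (norm u + 1))"
    have e: "0 < e" using r(1) by (simp add: e_def add_nonneg_pos)
    have "e * norm u < r"
    proof -
      have "e * norm u \<le> e * (norm u + 1)" using e by simp
      also have "\<dots> = r / 2"
        using norm_ge_zero[of u] by (simp add: e_def field_simps add_nonneg_eq_0_iff)
      finally show ?thesis using r(1) by simp
    qed
    then have "x - e *\<^sub>R u \<in> closed_cone m lam" using r(2) e by (auto simp: dist_norm subset_iff)
    then have "\<forall>j. e * u $ j \<le> x $ j" "\<forall>i\<in>{1..m}. e * lam i u \<le> lam i x"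
      using lin by (auto simp: closed_cone_def linear_diff linear_cmul)
    moreover have "\<forall>j. 0 < e * u $ j" "\<forall>i\<in>{1..m}. 0 < e * lam i u"
      using u e by (auto simp: strict_cone_def)
    ultimately show "x \<in> strict_cone m lam" unfolding strict_cone_def by (blast intro: less_le_trans)
  qed
qed

lemma strict_cone_lattice_points:
  assumes lin: "\<And>i. i \<in> {1..m} \<Longrightarrow> linear (lam i)"
    and one: "\<And>i. i \<in> {1..m} \<Longrightarrow> lam i 1 = 0"
  shows "x + 1 \<in> strict_cone m lam \<inter> lattice_points \<longleftrightarrow> x \<in> semiopen_cone m lam \<inter> lattice_points"
proof -
  have "lam i (x + 1) = lam i x" if "i \<in> {1..m}" for i
    using lin[OF that] one[OF that] by (simp add: linear_add)
  moreover have lat: "x + 1 \<in> lattice_points \<longleftrightarrow> x \<in> lattice_points"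
  proof
    assume a: "x + 1 \<in> lattice_points"
    have "x $ j = (x + 1) $ j - 1" for j by simp
    then show "x \<in> lattice_points"
      using a unfolding lattice_points_def mem_Collect_eq by (metis Ints_diff Ints_1)
  qed (auto simp: lattice_points_def)
  moreover have "0 < x $ j + 1 \<longleftrightarrow> 0 \<le> x $ j" if "x \<in> lattice_points" for j
  proof -
    have "x $ j \<in> \<int>" using that by (simp add: lattice_points_def)
    then obtain n :: int where n: "x $ j = of_int n" by (rule Ints_cases)
    have "0 < real_of_int n + 1 \<longleftrightarrow> 0 < n + 1" by (metis of_int_0_less_iff of_int_1 of_int_add)
    then show ?thesis by (simp add: n)
  qed
  ultimately show ?thesis by (auto simp: strict_cone_def semiopen_cone_def)
qed

text \<open>Translation by the all-ones vector raises the degree by the dimension. A degree below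
  the dimension is impossible in the strict cone, since the preimage would have negative
  degree.\<close>

lemma lattice_gf_strict_cone:
  fixes lam :: "nat \<Rightarrow> real ^ 'n \<Rightarrow> real"
  assumes lin: "\<And>i. i \<in> {1..m} \<Longrightarrow> linear (lam i)"
    and one: "\<And>i. i \<in> {1..m} \<Longrightarrow> lam i 1 = 0"
  shows "lattice_gf (strict_cone m lam) = fps_X ^ CARD('n) * lattice_gf (semiopen_cone m lam)"
proof (rule fps_ext)
  fix k
  note shift = strict_cone_lattice_points[of m lam, OF lin one]
  have sum1: "(\<Sum>j\<in>UNIV. (x + 1) $ j) = (\<Sum>j\<in>UNIV. x $ j) + real CARD('n)" for x :: "real ^ 'n"
    by (simp add: sum.distrib)
  have "strict_cone m lam \<inter> lattice_simplex k = (if k < CARD('n) then {}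
      else (\<lambda>x. x + 1) ` (semiopen_cone m lam \<inter> lattice_simplex (k - CARD('n))))" (is "?L = ?R")
  proof (intro equalityI subsetI)
    fix y assume y: "y \<in> ?L"
    define x where "x = y - 1"
    have yx: "y = x + 1" by (simp add: x_def)
    have x: "x \<in> semiopen_cone m lam \<inter> lattice_points"
      using y shift[of x] by (auto simp: yx lattice_simplex_def orthant_lattice_vector_def)
    then have nn: "\<forall>j. 0 \<le> x $ j" by (simp add: semiopen_cone_def)
    then have "0 \<le> (\<Sum>j\<in>UNIV. x $ j)" by (simp add: sum_nonneg)
    moreover have "(\<Sum>j\<in>UNIV. x $ j) + real CARD('n) = real k"
      using y sum1[of x] by (simp add: yx lattice_simplex_def)
    ultimately show "y \<in> ?R"
      using x nn by (auto simp: yx lattice_simplex_def orthant_lattice_vector_def of_nat_diff)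
  next
    fix y assume "y \<in> ?R"
    then obtain x where x: "\<not> k < CARD('n)" "y = x + 1" "x \<in> semiopen_cone m lam"
        "x \<in> lattice_simplex (k - CARD('n))"
      by (auto split: if_splits)
    then have "y \<in> strict_cone m lam \<inter> lattice_points"
      using shift[of x] by (auto simp: lattice_simplex_def orthant_lattice_vector_def)
    moreover have "(\<Sum>j\<in>UNIV. y $ j) = real k"
      using x sum1[of x] by (simp add: lattice_simplex_def of_nat_diff)
    ultimately show "y \<in> ?L"
      by (auto simp: lattice_simplex_def orthant_lattice_vector_def strict_cone_def less_imp_le)
  qed
  then show "fps_nth (lattice_gf (strict_cone m lam)) k
      = fps_nth (fps_X ^ CARD('n) * lattice_gf (semiopen_cone m lam)) k"
    by (simp add: lattice_gf_def fps_X_power_mult_nth card_image)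
qed

text \<open>Each form is replaced by a positive multiple with an integral normal vector, which
  changes no sign and makes \<open>cone_reciprocity\<close> applicable.\<close>

lemma reciprocal_series_cones:
  fixes lam :: "nat \<Rightarrow> real ^ 'n \<Rightarrow> real"
  assumes lin: "\<And>i. i \<in> {1..m} \<Longrightarrow> linear (lam i)"
    and rat: "\<forall>i\<in>{1..m}. rational_form (lam i)"
    and u: "u \<in> strict_cone m lam"
  shows "reciprocal_series CARD('n) (lattice_gf (closed_cone m lam)) (lattice_gf (strict_cone m lam))"
proof -
  have "\<exists>w c. w \<in> lattice_points \<and> 0 < c \<and> (\<forall>x. w \<bullet> x = c * lam i x)" if "i \<in> {1..m}" for i
    by (rule rational_form_lattice_vector[OF lin[OF that]]) (use rat that in blast)+
  then obtain w c where w: "\<And>i. i \<in> {1..m} \<Longrightarrow> w i \<in> lattice_points"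
      "\<And>i. i \<in> {1..m} \<Longrightarrow> 0 < c i" "\<And>i x. i \<in> {1..m} \<Longrightarrow> w i \<bullet> x = c i * lam i x"
    by metis
  have sgn: "0 \<le> lam i x \<longleftrightarrow> 0 \<le> w i \<bullet> x" "0 < lam i x \<longleftrightarrow> 0 < w i \<bullet> x" if "i \<in> {1..m}" for i x
    using w(2)[OF that] by (simp_all add: w(3)[OF that] zero_le_mult_iff zero_less_mult_iff)
  have closed: "closed_cone m lam = {x. (\<forall>j. 0 \<le> x $ j) \<and> (\<forall>l\<in>w ` {1..m}. 0 \<le> l \<bullet> x)}"
    by (simp only: closed_cone_def ball_simps sgn cong: ball_cong)
  have strict: "strict_cone m lam = {x. (\<forall>j. 0 < x $ j) \<and> (\<forall>l\<in>w ` {1..m}. 0 < l \<bullet> x)}"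
    by (simp only: strict_cone_def ball_simps sgn cong: ball_cong)
  show ?thesis
    using u w(1) unfolding closed strict by (intro cone_reciprocity[of _ u]) auto
qed

section \<open>Ehrhart series of the polytopes as generating functions of the cones\<close>

lemma ehrhart_series_semiopen:
  fixes lam :: "nat \<Rightarrow> real ^ 'n \<Rightarrow> real"
  assumes lin: "\<And>i. i \<in> {1..m} \<Longrightarrow> linear (lam i)"
    and one: "\<And>i. i \<in> {1..m} \<Longrightarrow> lam i 1 = 0"
    and ne: "semiopen_polytope m lam \<noteq> {}"
  shows "ehrhart_series (semiopen_polytope m lam) = fps_to_fls (lattice_gf (semiopen_cone m lam))"
proof -
  have "{x \<in> semiopen_cone m lam \<inter> lattice_points. (\<Sum>j\<in>UNIV. x $ j) = real k}
      = semiopen_cone m lam \<inter> lattice_simplex k" for k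
    by (auto simp: semiopen_cone_def lattice_simplex_def orthant_lattice_vector_def)
  then have "ehrhart (semiopen_polytope m lam) k = card (semiopen_cone m lam \<inter> lattice_simplex k)" for k
    using ehrhart_semiopen_polytope[of m lam k] lin one ne by simp
  then show ?thesis by (simp add: ehrhart_series_def lattice_gf_def)
qed

lemma ehrhart_series_closure:
  fixes lam :: "nat \<Rightarrow> real ^ 'n \<Rightarrow> real"
  assumes lin: "\<And>i. i \<in> {1..m} \<Longrightarrow> linear (lam i)"
    and ne: "semiopen_polytope m lam \<noteq> {}"
  shows "ehrhart_series (closure (semiopen_polytope m lam)) = fps_to_fls (lattice_gf (closed_cone m lam))"
proof -
  have "{x \<in> closed_cone m lam \<inter> lattice_points. (\<Sum>j\<in>UNIV. x $ j) = real k}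
      = closed_cone m lam \<inter> lattice_simplex k" for k
    by (auto simp: closed_cone_def lattice_simplex_def orthant_lattice_vector_def)
  then have "ehrhart (closure (semiopen_polytope m lam)) k = card (closed_cone m lam \<inter> lattice_simplex k)" for k
    using ehrhart_closure_semiopen_polytope[of m lam k] lin ne by simp
  then show ?thesis by (simp add: ehrhart_series_def lattice_gf_def)
qed

text \<open>After the substitution j -> s - j the exponent w + s - j equals -d + G - j. Integer
  powers are used because w may be negative.\<close>

lemma reversed_numerator:
  fixes z :: "'a :: field"
  assumes "z \<noteq> 0" "w = int G - int d - int s"
  shows "(\<Sum>j=0..s. h (s - j) * z powi (w + int j))
    = z powi (- int d) * (z ^ G * (\<Sum>j=0..s. h j * inverse z ^ j))"
proof -
  have "(\<Sum>j=0..s. h (s - j) * z powi (w + int j)) = (\<Sum>j=0..s. h j * z powi (w + int (s - j)))"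
    by (rule sum.reindex_bij_witness[of _ "\<lambda>j. s - j" "\<lambda>j. s - j"]) auto
  also have "\<dots> = (\<Sum>j=0..s. z powi (- int d) * (z ^ G * (h j * inverse z ^ j)))"
  proof (rule sum.cong)
    fix j assume "j \<in> {0..s}"
    then have w: "w + int (s - j) = - int d + (int G + - int j)" using assms(2) by simp
    have "z powi (w + int (s - j)) = z powi (- int d) * z powi (int G + - int j)"
      unfolding w using assms(1) by (intro power_int_add) simp
    also have "z powi (int G + - int j) = z powi int G * z powi (- int j)"
      using assms(1) by (intro power_int_add) simp
    finally have "z powi (w + int (s - j)) = z powi (- int d) * (z powi int G * z powi (- int j))" .
    then show "h j * z powi (w + int (s - j)) = z powi (- int d) * (z ^ G * (h j * inverse z ^ j))"
      by (simp add: power_int_minus power_inverse)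
  qed simp
  finally show ?thesis by (simp add: sum_distrib_left)
qed

theorem theorem3p1:
  fixes lam :: "nat \<Rightarrow> real ^ 'n \<Rightarrow> real" and m :: nat
  assumes "\<And>i. i \<in> {1..m} \<Longrightarrow> linear (lam i)"
    and "\<And>i. i \<in> {1..m} \<Longrightarrow> lam i 1 = 0"
    and "aff_dim (semiopen_polytope m lam) = int CARD('n) - 1"
  shows "semiopen_cone m lam \<inter> lattice_points
           = (\<lambda>x. x - 1) ` (interior (closed_cone m lam) \<inter> lattice_points)
    \<and> ((\<forall>i\<in>{1..m}. rational_form (lam i)) \<longrightarrow>
         (\<exists>p q. q \<noteq> 0 \<and>
            ehrhart_series (closure (semiopen_polytope m lam)) = ratfun p q fls_X \<and>
            ehrhart_series (semiopen_polytope m lam)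
              = (- 1) ^ CARD('n) * fls_X powi (- int CARD('n)) * ratfun p q (inverse fls_X)))
    \<and> ((\<forall>i\<in>{1..m}. rational_form (lam i)) \<longrightarrow>
         (\<forall>(s :: nat) (h :: nat \<Rightarrow> int) (g :: nat \<Rightarrow> nat) (w :: int).
            (\<forall>i\<in>{1..CARD('n)}. 0 < g i) \<longrightarrow>
            w = (\<Sum>i=1..CARD('n). int (g i)) - int CARD('n) - int s \<longrightarrow>
            ehrhart_series (closure (semiopen_polytope m lam))
              = (\<Sum>j=0..s. of_int (h j) * fls_X ^ j) / (\<Prod>i=1..CARD('n). 1 - fls_X ^ g i) \<longrightarrow>
            ehrhart_series (semiopen_polytope m lam)
              = (\<Sum>j=0..s. of_int (h (s - j)) * fls_X powi (w + int j))
                / (\<Prod>i=1..CARD('n). 1 - fls_X ^ g i)))"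
proof -
  note lin = assms(1) and one = assms(2)
  let ?d = "CARD('n)"
  let ?EP = "ehrhart_series (semiopen_polytope m lam)"
  let ?EC = "ehrhart_series (closure (semiopen_polytope m lam))"
  \<comment> \<open>The empty set has affine dimension -1, whereas here the dimension is at least
    0.\<close>
  have ne: "semiopen_polytope m lam \<noteq> {}" using assms(3) by (auto simp: aff_dim_empty)
  then obtain p where "p \<in> semiopen_cone m lam" by (auto simp: semiopen_polytope_def)
  \<comment> \<open>Adding the all-ones vector makes every coordinate positive and leaves all forms
    unchanged.\<close>
  then have u: "p + 1 \<in> strict_cone m lam"
    using lin one by (auto simp: strict_cone_def semiopen_cone_def linear_add add_nonneg_pos)
  have interior: "interior (closed_cone m lam) = strict_cone m lam"
    using lin u by (rule interior_closed_cone)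
  have shift: "x + 1 \<in> strict_cone m lam \<inter> lattice_points
      \<longleftrightarrow> x \<in> semiopen_cone m lam \<inter> lattice_points" for x
    using lin one by (rule strict_cone_lattice_points)
  have part1: "semiopen_cone m lam \<inter> lattice_points
      = (\<lambda>x. x - 1) ` (interior (closed_cone m lam) \<inter> lattice_points)"
    unfolding interior
  proof (intro equalityI subsetI)
    fix x assume "x \<in> semiopen_cone m lam \<inter> lattice_points"
    then have "x + 1 \<in> strict_cone m lam \<inter> lattice_points"
      using shift by blast
    then show "x \<in> (\<lambda>x. x - 1) ` (strict_cone m lam \<inter> lattice_points)"
      by (rule rev_image_eqI) simp
  next
    fix x assume "x \<in> (\<lambda>x. x - 1) ` (strict_cone m lam \<inter> lattice_points)"
    then have "x + 1 \<in> strict_cone m lam \<inter> lattice_points" by auto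
    then show "x \<in> semiopen_cone m lam \<inter> lattice_points"
      using shift by blast
  qed
  have EP: "?EP = fps_to_fls (lattice_gf (semiopen_cone m lam))"
    using lin one ne by (rule ehrhart_series_semiopen)
  have EC: "?EC = fps_to_fls (lattice_gf (closed_cone m lam))"
    using lin ne by (rule ehrhart_series_closure)
  have gf: "lattice_gf (strict_cone m lam) = fps_X ^ ?d * lattice_gf (semiopen_cone m lam)"
    using lin one by (rule lattice_gf_strict_cone)
  have part2: "\<exists>p q. q \<noteq> 0 \<and> ?EC = ratfun p q fls_X
      \<and> ?EP = (- 1) ^ ?d * fls_X powi (- int ?d) * ratfun p q (inverse fls_X)"
    if rat: "\<forall>i\<in>{1..m}. rational_form (lam i)"
  proof -
    obtain p q where pq: "q \<noteq> 0" "fps_to_fls (lattice_gf (closed_cone m lam)) = ratfun p q fls_X"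
        "fps_to_fls (lattice_gf (strict_cone m lam)) = (- 1) ^ ?d * ratfun p q (inverse fls_X)"
      using reciprocal_series_cones[OF lin rat u] unfolding reciprocal_series_def by blast
    \<comment> \<open>Reciprocity speaks about the interior of the cone, whose series is t^d times
      that of the semiopen polytope; the power of t is then cancelled.\<close>
    have shifted: "fls_X ^ ?d * ?EP = (- 1) ^ ?d * ratfun p q (inverse fls_X)"
      unfolding pq(3)[symmetric] gf by (simp add: EP fls_times_fps_to_fls fps_to_fls_power)
    have X: "(fls_X :: rat fls) powi (- int ?d) * fls_X ^ ?d = 1"
      by (subst power_int_minus) (simp only: power_int_of_nat, simp)
    have "?EP = (fls_X powi (- int ?d) * fls_X ^ ?d) * ?EP" by (simp only: X mult_1)
    also have "\<dots> = fls_X powi (- int ?d) * (fls_X ^ ?d * ?EP)" by (rule mult.assoc)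
    finally have "?EP = fls_X powi (- int ?d) * ((- 1) ^ ?d * ratfun p q (inverse fls_X))"
      unfolding shifted .
    then have "?EP = (- 1) ^ ?d * fls_X powi (- int ?d) * ratfun p q (inverse fls_X)"
      by (simp only: mult.assoc mult.left_commute)
    moreover have "?EC = ratfun p q fls_X" using EC pq(2) by (rule trans)
    ultimately show ?thesis using pq(1) by (intro exI conjI)
  qed
  have part3: "?EP = (\<Sum>j=0..s. of_int (h (s - j)) * fls_X powi (w + int j)) / (\<Prod>i=1..?d. 1 - fls_X ^ g i)"
    if rat: "\<forall>i\<in>{1..m}. rational_form (lam i)" and g: "\<forall>i\<in>{1..?d}. 0 < g i"
      and w: "w = (\<Sum>i=1..?d. int (g i)) - int ?d - int s"
      and EC_eq: "?EC = (\<Sum>j=0..s. of_int (h j) * fls_X ^ j) / (\<Prod>i=1..?d. 1 - fls_X ^ g i)"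
    for s w :: _ and h :: "nat \<Rightarrow> int" and g :: "nat \<Rightarrow> nat"
  proof -
    obtain p q where pq: "q \<noteq> 0" "?EC = ratfun p q fls_X"
        "?EP = (- 1) ^ ?d * fls_X powi (- int ?d) * ratfun p q (inverse fls_X)"
      using part2[OF rat] by blast
    define P where "P = (\<Sum>j=0..s. monom (of_int (h j)) j :: rat poly)"
    define Q where "Q = geometric_denominator g {1..?d}"
    have P: "fls_eval z P = (\<Sum>j=0..s. of_int (h j) * z ^ j)" for z
      by (simp add: P_def fls_eval_sum fls_eval_monom fls_of_int)
    have Q: "Q \<noteq> 0" unfolding Q_def using g by (intro geometric_denominator_nonzero) auto
    have "?EC = ratfun P Q fls_X"
      by (simp only: EC_eq ratfun_eq_fls_eval P Q_def fls_eval_geometric_denominator)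
    \<comment> \<open>The fraction provided by reciprocity may differ from the given one. They agree
      at t, hence also at 1/t.\<close>
    then have "ratfun p q (inverse fls_X) = ratfun P Q (inverse fls_X)"
      using pq(2) by (intro ratfun_inverse_fls_X_cong pq(1) Q) simp
    then have "?EP = fls_X powi (- int ?d) * ((- 1) ^ card {1..?d} * ratfun P Q (inverse fls_X))"
      unfolding pq(3) by (simp only: card_atLeastAtMost diff_Suc_1 mult.assoc mult.left_commute)
    also have "(- 1) ^ card {1..?d} * ratfun P Q (inverse fls_X)
        = fls_X ^ (\<Sum>i=1..?d. g i) * fls_eval (inverse fls_X) P / (\<Prod>i=1..?d. 1 - fls_X ^ g i)"
      unfolding Q_def using g by (intro ratfun_geometric_denominator) auto
    finally have *: "?EP = fls_X powi (- int ?d) * (fls_X ^ (\<Sum>i=1..?d. g i)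
        * (\<Sum>j=0..s. of_int (h j) * inverse fls_X ^ j)) / (\<Prod>i=1..?d. 1 - fls_X ^ g i)"
      by (simp only: P times_divide_eq_right)
    have w': "w = int (\<Sum>i=1..?d. g i) - int ?d - int s" using w by simp
    show ?thesis
      unfolding reversed_numerator[OF fls_X_nonzero w', of "\<lambda>j. of_int (h j)"] by (rule *)
  qed
  show ?thesis using part1 part2 part3 by blast
qed

end
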